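(* Let $K=\{4^m: m\ge 1\}\cup\{2\cdot p^m+2: p\in\{7,31,127\},\ m\ge 1\}$. There exists a $\mathrm{TOC}_3(n,3,3)$ for every $n\in K$.
   Context: $\mathcal{H}_q(n,w)$ is the set of all words of length $n$ over $\mathbb{Z}_q$ with exactly $w$ nonzero entries, with the Hamming distance. An $(n,d,w)_q$-code is a nonempty subset of $\mathcal{H}_q(n,w)$ in which any two distinct words have Hamming distance at least $d$; $A_q(n,d,w)$ is the maximum size of such a code and a code of this size is optimal. A $\mathrm{TOC}_q(n,d,w)$ is a partition of $\mathcal{H}_q(n,w)$ into mutually disjoint optimal $(n,d,w)_q$-codes. *)

theory Defs
  imports Main
begin

text \<open>Words of length n over Z_q are lists of length n with entries in {0..<q}.\<close>

definition wt :: "nat list \<Rightarrow> nat" where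
  "wt x = card {i. i < length x \<and> x ! i \<noteq> 0}"

definition hdist :: "nat list \<Rightarrow> nat list \<Rightarrow> nat" where
  "hdist x y = card {i. i < length x \<and> x ! i \<noteq> y ! i}"

definition Hq :: "nat \<Rightarrow> nat \<Rightarrow> nat \<Rightarrow> nat list set" where
  "Hq q n w = {x. length x = n \<and> set x \<subseteq> {..<q} \<and> wt x = w}"

definition is_code :: "nat \<Rightarrow> nat \<Rightarrow> nat \<Rightarrow> nat \<Rightarrow> nat list set \<Rightarrow> bool" where
  "is_code q n d w C \<longleftrightarrow> C \<noteq> {} \<and> C \<subseteq> Hq q n w \<and>
     (\<forall>x\<in>C. \<forall>y\<in>C. x \<noteq> y \<longrightarrow> d \<le> hdist x y)"

definition Aq :: "nat \<Rightarrow> nat \<Rightarrow> nat \<Rightarrow> nat \<Rightarrow> nat" where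
  "Aq q n d w = Max {card C | C. is_code q n d w C}"

definition optimal_code :: "nat \<Rightarrow> nat \<Rightarrow> nat \<Rightarrow> nat \<Rightarrow> nat list set \<Rightarrow> bool" where
  "optimal_code q n d w C \<longleftrightarrow> is_code q n d w C \<and> card C = Aq q n d w"

definition is_TOC :: "nat \<Rightarrow> nat \<Rightarrow> nat \<Rightarrow> nat \<Rightarrow> nat list set set \<Rightarrow> bool" where
  "is_TOC q n d w P \<longleftrightarrow> \<Union>P = Hq q n w \<and>
     (\<forall>C\<in>P. optimal_code q n d w C) \<and>
     (\<forall>C\<in>P. \<forall>D\<in>P. C \<noteq> D \<longrightarrow> C \<inter> D = {})"

definition Kset :: "nat set" where
  "Kset = {4 ^ m | m. m \<ge> 1} \<union> {2 * p ^ m + 2 | p m. p \<in> {7, 31, 127} \<and> m \<ge> 1}"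

end

theory Submission
  imports Defs "HOL-Algebra.Algebraic_Closure_Type" "HOL-Library.Z2" "HOL-Library.Product_Plus"
    "HOL-Library.FuncSet" "HOL-Library.Numeral_Type"
begin

text \<open>Restricting a word of an \<open>(n,3,3)\<close>-code to two places of its support gives a word of weight 2,
  and no word of weight 2 arises twice. This bounds the size of codes, and a colouring of all words
  of weight 3 with \<open>2(n-2)\<close> colours, in which words at distance less than 3 have different colours, must
  have optimal codes as colour classes.

  Such a colouring lives on two points over each point of a linear space together with two points at
  infinity, if each line of the linear space has \<open>2^k - 1\<close> points with odd \<open>k\<close>. The points over a line
  and at infinity carry Baker's Steiner quadruple system of order \<open>2^(k+1)\<close>, resolved into
  \<open>S(2,4,2^(k+1))\<close>-systems that are indexed by the points of the line. A word over a line is coloured by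
  the class of its block and by its place in a tiling of the words on the block by four images of the
  tetracode. A word over a triangle is coloured by the centroid of the triangle and by a Latin cube of
  order 4.

  A single line gives \<open>n = 4^m\<close>; affine spaces over the fields of order 7, 31 and 127 give the other
  values of \<open>n\<close>.\<close>

section \<open>Optimal codes from proper colourings\<close>

lemma finite_Hq: "finite (Hq q n w)"
  by (rule finite_subset[OF _ finite_lists_length_eq[of "{..<q}" n]]) (auto simp: Hq_def)

lemma wt_Cons: "wt (a # x) = (if a = 0 then wt x else Suc (wt x))"
proof -
  let ?I = "{i. i < length x \<and> x ! i \<noteq> 0}"
  have "{i. i < length (a # x) \<and> (a # x) ! i \<noteq> 0} = (if a = 0 then {} else {0}) \<union> Suc ` ?I"
    by (auto simp: less_Suc_eq_0_disj split: if_splits)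
  moreover have "card (Suc ` ?I) = wt x"
    by (simp add: wt_def card_image)
  ultimately show ?thesis
    by (simp add: wt_def card_insert_if image_iff)
qed

lemma Cons_in_Hq_iff:
  "a # x \<in> Hq q (Suc n) w \<longleftrightarrow>
    (if a = 0 then q > 0 \<and> x \<in> Hq q n w else a < q \<and> w > 0 \<and> x \<in> Hq q n (w - 1))"
  by (cases w) (auto simp: Hq_def wt_Cons)

lemma Hq_Suc_0:
  assumes "q > 0"
  shows "Hq q (Suc n) 0 = Cons 0 ` Hq q n 0" (is "?L = ?R")
proof (rule Set.set_eqI)
  fix y
  show "y \<in> ?L \<longleftrightarrow> y \<in> ?R"
  proof (cases y)
    case (Cons a x)
    then show ?thesis
      using assms by (auto simp: Cons_in_Hq_iff split: if_splits)
  qed (auto simp: Hq_def)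
qed

lemma Hq_Suc_Suc:
  assumes "q > 0"
  shows "Hq q (Suc n) (Suc w) =
    Cons 0 ` Hq q n (Suc w) \<union> (\<lambda>(a, x). a # x) ` ({1..<q} \<times> Hq q n w)" (is "?L = ?R")
proof (rule Set.set_eqI)
  fix y
  show "y \<in> ?L \<longleftrightarrow> y \<in> ?R"
  proof (cases y)
    case (Cons a x)
    then show ?thesis
      using assms by (auto simp: Cons_in_Hq_iff image_iff split: if_splits)
  qed (auto simp: Hq_def)
qed

lemma card_Hq:
  assumes "q > 0"
  shows "card (Hq q n w) = (n choose w) * (q - 1) ^ w"
proof (induction n arbitrary: w)
  case 0
  have "Hq q 0 w = (if w = 0 then {[]} else {})"
    by (auto simp: Hq_def wt_def)
  then show ?case
    by (simp add: binomial_eq_0)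
next
  case (Suc n)
  show ?case
  proof (cases w)
    case 0
    then show ?thesis
      using Suc.IH[of 0] assms by (simp add: Hq_Suc_0 card_image)
  next
    case (Suc v)
    let ?cons = "\<lambda>(a, x). a # x :: nat list"
    have "card (?cons ` ({1..<q} \<times> Hq q n v)) = (q - 1) * card (Hq q n v)"
      by (subst card_image) (auto simp: inj_on_def card_cartesian_product)
    moreover have "card (Cons 0 ` Hq q n (Suc v)) = card (Hq q n (Suc v))"
      by (simp add: card_image)
    moreover have "Cons 0 ` Hq q n (Suc v) \<inter> ?cons ` ({1..<q} \<times> Hq q n v) = {}"
      by auto
    ultimately have "card (Hq q (Suc n) (Suc v)) = card (Hq q n (Suc v)) + (q - 1) * card (Hq q n v)"
      using assms by (simp add: Hq_Suc_Suc card_Un_disjoint finite_Hq)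
    then show ?thesis
      unfolding Suc Suc.IH by (simp add: distrib_left distrib_right mult.left_commute)
  qed
qed

definition restrict_word :: "nat set \<Rightarrow> nat list \<Rightarrow> nat list" where
  "restrict_word S x = map (\<lambda>i. if i \<in> S then x ! i else 0) [0..<length x]"

lemma length_restrict_word [simp]: "length (restrict_word S x) = length x"
  by (simp add: restrict_word_def)

lemma nth_restrict_word [simp]:
  "i < length x \<Longrightarrow> restrict_word S x ! i = (if i \<in> S then x ! i else 0)"
  by (simp add: restrict_word_def nth_upt)

lemma restrict_word_in_Hq:
  assumes "x \<in> Hq q n w" "S \<subseteq> {i. i < n \<and> x ! i \<noteq> 0}"
  shows "restrict_word S x \<in> Hq q n (card S)"
proof -
  have x: "length x = n" "set x \<subseteq> {..<q}"
    using assms(1) by (auto simp: Hq_def)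
  have "{i. i < length (restrict_word S x) \<and> restrict_word S x ! i \<noteq> 0} = S"
    using assms(2) x(1) by (auto split: if_splits)
  moreover have "restrict_word S x ! i < q" if "i < n" for i
  proof -
    have "x ! i \<in> {..<q}"
      using x that by (metis nth_mem subsetD)
    then show ?thesis
      using x(1) that by simp
  qed
  ultimately show ?thesis
    using x(1) by (auto simp: Hq_def wt_def in_set_conv_nth)
qed

lemma hdist_le_of_common_nonzeros:
  assumes x: "x \<in> Hq q n w" and y: "y \<in> Hq q n w"
    and S: "\<And>i. i \<in> S \<Longrightarrow> i < n \<and> x ! i \<noteq> 0 \<and> x ! i = y ! i"
  shows "hdist x y \<le> 2 * (w - card S)"
proof -
  define nonzeros where "nonzeros z = {i. i < n \<and> z ! i \<noteq> 0}" for z :: "nat list"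
  have S_sub: "S \<subseteq> nonzeros x" "S \<subseteq> nonzeros y"
    using S by (fastforce simp: nonzeros_def)+
  have card_nonzeros: "card (nonzeros x) = w" "card (nonzeros y) = w"
    and len: "length x = n"
    using x y by (auto simp: Hq_def wt_def nonzeros_def)
  have fin: "finite (nonzeros z)" for z
    by (simp add: nonzeros_def)
  have "hdist x y \<le> card ((nonzeros x - S) \<union> (nonzeros y - S))"
    unfolding hdist_def len by (rule card_mono) (use S fin in \<open>auto simp: nonzeros_def\<close>)
  also have "\<dots> \<le> card (nonzeros x - S) + card (nonzeros y - S)"
    by (rule card_Un_le)
  also have "\<dots> = 2 * (w - card S)"
    using S_sub fin card_nonzeros by (simp add: card_Diff_subset finite_subset)
  finally show ?thesis .
qed

lemma inj_on_restrict_word: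
  assumes code: "is_code q n d w C" and d: "2 * (w - t) < d"
  shows "inj_on (\<lambda>(x, S). restrict_word S x)
    (SIGMA x:C. {S. S \<subseteq> {i. i < n \<and> x ! i \<noteq> 0} \<and> card S = t})" (is "inj_on _ ?flags")
proof (rule inj_onI)
  fix p p'
  assume flags: "p \<in> ?flags" "p' \<in> ?flags"
    and same_word: "(\<lambda>(x, S). restrict_word S x) p = (\<lambda>(x, S). restrict_word S x) p'"
  obtain x S y R where p: "p = (x, S)" "p' = (y, R)"
    by (cases p; cases p')
  then have xy: "x \<in> C" "y \<in> C" "card S = t"
    and S: "\<And>i. i \<in> S \<Longrightarrow> i < n \<and> x ! i \<noteq> 0" and R: "\<And>i. i \<in> R \<Longrightarrow> i < n \<and> y ! i \<noteq> 0"
    and eq: "restrict_word S x = restrict_word R y"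
    using flags same_word by auto
  then have words: "x \<in> Hq q n w" "y \<in> Hq q n w"
    using code by (auto simp: is_code_def)
  then have entries: "(if i \<in> S then x ! i else 0) = (if i \<in> R then y ! i else 0)" if "i < n" for i
    using arg_cong[OF eq, of "\<lambda>z. z ! i"] that by (simp add: Hq_def)
  then have "S = R"
    using S R by (metis subsetI subset_antisym)
  then have "hdist x y \<le> 2 * (w - card S)"
    using S entries by (intro hdist_le_of_common_nonzeros[OF words]) fastforce
  then have "x = y"
    using code xy d unfolding is_code_def by (meson le_less_trans not_le)
  then show "p = p'"
    using p \<open>S = R\<close> by simp
qed

theorem card_code_times_choose_le:
  assumes "q > 0" and code: "is_code q n d w C" and d: "2 * (w - t) < d"
  shows "card C * (w choose t) \<le> (n choose t) * (q - 1) ^ t"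
proof -
  define nonzeros where "nonzeros x = {i. i < n \<and> x ! i \<noteq> 0}" for x :: "nat list"
  define flags where "flags = (SIGMA x:C. {S. S \<subseteq> nonzeros x \<and> card S = t})"
  have C: "C \<subseteq> Hq q n w"
    using code by (simp add: is_code_def)
  then have "finite C"
    using finite_Hq finite_subset by blast
  have nonzeros: "finite (nonzeros x)" "card (nonzeros x) = w" if "x \<in> C" for x
    using that C by (auto simp: nonzeros_def Hq_def wt_def)
  have "card flags = (\<Sum>x\<in>C. card {S. S \<subseteq> nonzeros x \<and> card S = t})"
    unfolding flags_def using \<open>finite C\<close> nonzeros(1) by (intro card_SigmaI) auto
  also have "\<dots> = card C * (w choose t)"
    using nonzeros by (simp add: n_subsets)
  finally have "card C * (w choose t) = card flags" ..
  also have "\<dots> \<le> card (Hq q n t)"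
  proof (rule card_inj_on_le[OF _ _ finite_Hq])
    show "(\<lambda>(x, S). restrict_word S x) ` flags \<subseteq> Hq q n t"
      using restrict_word_in_Hq C by (fastforce simp: flags_def nonzeros_def)
    show "inj_on (\<lambda>(x, S). restrict_word S x) flags"
      unfolding flags_def nonzeros_def by (rule inj_on_restrict_word[OF code d])
  qed
  finally show ?thesis
    by (simp add: card_Hq \<open>q > 0\<close>)
qed

lemma is_TOC_colour_classes:
  fixes q n d w :: nat and f :: "nat list \<Rightarrow> 'c"
  defines "colour_class c \<equiv> {x \<in> Hq q n w. f x = c}"
  assumes distant: "\<And>x y. x \<in> Hq q n w \<Longrightarrow> y \<in> Hq q n w \<Longrightarrow> f x = f y \<Longrightarrow> x \<noteq> y \<Longrightarrow> d \<le> hdist x y"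
    and card_le: "\<And>C. is_code q n d w C \<Longrightarrow> card (f ` Hq q n w) * card C \<le> card (Hq q n w)"
  shows "is_TOC q n d w (colour_class ` f ` Hq q n w)"
proof -
  let ?K = "f ` Hq q n w"
  have code: "is_code q n d w (colour_class c)" if "c \<in> ?K" for c
    using that distant by (auto simp: is_code_def colour_class_def)
  have "Hq q n w = (\<Union>c\<in>?K. colour_class c)"
    by (auto simp: colour_class_def)
  moreover have "card (\<Union>c\<in>?K. colour_class c) = (\<Sum>c\<in>?K. card (colour_class c))"
    by (rule card_UN_disjoint) (auto simp: colour_class_def finite_Hq)
  ultimately have total: "card (Hq q n w) = (\<Sum>c\<in>?K. card (colour_class c))"
    by simp
  have average: "card ?K * card (colour_class c) = card (Hq q n w)" if "c \<in> ?K" for c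
  proof (rule ccontr)
    assume "card ?K * card (colour_class c) \<noteq> card (Hq q n w)"
    then have "card ?K * card (colour_class c) < card (Hq q n w)"
      using card_le[OF code[OF that]] by simp
    then have "(\<Sum>c\<in>?K. card ?K * card (colour_class c)) < (\<Sum>c\<in>?K. card (Hq q n w))"
      using card_le[OF code] that by (intro sum_strict_mono_ex1) (auto simp: finite_Hq)
    then show False
      using total by (simp flip: sum_distrib_left)
  qed
  have "optimal_code q n d w (colour_class c)" if "c \<in> ?K" for c
  proof -
    have "card ?K > 0"
      using that by (auto simp: card_gt_0_iff finite_Hq)
    then have max: "card C \<le> card (colour_class c)" if "is_code q n d w C" for C
      using card_le[OF that] average[OF \<open>c \<in> ?K\<close>] by (metis mult_le_cancel1)
    then have "finite {card C |C. is_code q n d w C}"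
      by (auto intro: finite_subset[OF _ finite_atMost])
    then show ?thesis
      unfolding optimal_code_def Aq_def
      using max code[OF that] by (intro conjI Max_eqI[symmetric]) auto
  qed
  then show ?thesis
    unfolding is_TOC_def by (auto simp: colour_class_def)
qed

theorem is_TOC_of_few_colours:
  assumes "q > 0" "t \<le> w" "w \<le> n" "2 * (w - t) < d"
    and distant: "\<And>x y. x \<in> Hq q n w \<Longrightarrow> y \<in> Hq q n w \<Longrightarrow> f x = f y \<Longrightarrow> x \<noteq> y \<Longrightarrow> d \<le> hdist x y"
    and few: "card (f ` Hq q n w) \<le> (n - t choose (w - t)) * (q - 1) ^ (w - t)"
  shows "\<exists>P. is_TOC q n d w P"
proof -
  have "card (f ` Hq q n w) * card C \<le> card (Hq q n w)" if "is_code q n d w C" for C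
  proof -
    have "(card (f ` Hq q n w) * card C) * (w choose t)
        \<le> ((n - t choose (w - t)) * (q - 1) ^ (w - t)) * ((n choose t) * (q - 1) ^ t)"
      unfolding mult.assoc
      using few card_code_times_choose_le[OF \<open>q > 0\<close> that \<open>2 * (w - t) < d\<close>]
      by (metis mult.assoc mult_le_mono)
    also have "\<dots> = ((n choose t) * (n - t choose (w - t))) * ((q - 1) ^ (w - t) * (q - 1) ^ t)"
      by (simp only: ac_simps)
    also have "\<dots> = ((n choose w) * (w choose t)) * (q - 1) ^ w"
      using \<open>t \<le> w\<close> \<open>w \<le> n\<close> by (simp add: choose_mult flip: power_add)
    also have "\<dots> = card (Hq q n w) * (w choose t)"
      by (simp add: card_Hq \<open>q > 0\<close>)
    finally show ?thesis
      using \<open>t \<le> w\<close> by simp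
  qed
  then show ?thesis
    using is_TOC_colour_classes[of q n w f d] distant by blast
qed

section \<open>Words as functions\<close>

definition supp :: "('a \<Rightarrow> nat) \<Rightarrow> 'a set" where
  "supp x = {a. x a \<noteq> 0}"

definition hamming :: "('a \<Rightarrow> nat) \<Rightarrow> ('a \<Rightarrow> nat) \<Rightarrow> nat" where
  "hamming x y = card {a. x a \<noteq> y a}"

definition words :: "nat \<Rightarrow> 'a set \<Rightarrow> nat \<Rightarrow> ('a \<Rightarrow> nat) set" where
  "words q A w = {x. supp x \<subseteq> A \<and> card (supp x) = w \<and> (\<forall>a. x a < q)}"

definition proper_colouring :: "nat \<Rightarrow> ('a \<Rightarrow> nat) set \<Rightarrow> (('a \<Rightarrow> nat) \<Rightarrow> 'c) \<Rightarrow> bool" where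
  "proper_colouring d W f \<longleftrightarrow> (\<forall>x\<in>W. \<forall>y\<in>W. f x = f y \<longrightarrow> x \<noteq> y \<longrightarrow> d \<le> hamming x y)"

lemma proper_colouringI:
  assumes "\<And>x y. x \<in> W \<Longrightarrow> y \<in> W \<Longrightarrow> f x = f y \<Longrightarrow> hamming x y < d \<Longrightarrow> x = y"
  shows "proper_colouring d W f"
  using assms unfolding proper_colouring_def by (meson not_le)

lemma proper_colouringD:
  "proper_colouring d W f \<Longrightarrow> x \<in> W \<Longrightarrow> y \<in> W \<Longrightarrow> f x = f y \<Longrightarrow> hamming x y < d \<Longrightarrow> x = y"
  unfolding proper_colouring_def by (meson not_le)

lemma in_wordsD:
  assumes "x \<in> words q A w"
  shows "supp x \<subseteq> A" "card (supp x) = w" "x a < q"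
  using assms by (auto simp: words_def)

lemma word_eq_0_outside: "x \<in> words q A w \<Longrightarrow> a \<notin> A \<Longrightarrow> x a = 0"
  by (auto simp: words_def supp_def)

lemma finite_supp_word: "x \<in> words q A w \<Longrightarrow> w > 0 \<Longrightarrow> finite (supp x)"
  by (auto simp: words_def intro: card_ge_0_finite)

lemma card_supp_add_le:
  assumes "finite (supp x)" "finite (supp y)"
  shows "card (supp x) + card (supp y) \<le> 2 * card (supp x \<inter> supp y) + hamming x y"
proof -
  have fin: "finite {a. x a \<noteq> y a}"
    by (rule finite_subset[of _ "supp x \<union> supp y"]) (use assms in \<open>auto simp: supp_def\<close>)
  have "card (supp x - supp y) + card (supp y - supp x) = card ((supp x - supp y) \<union> (supp y - supp x))"
    using assms by (subst card_Un_disjoint) auto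
  also have "\<dots> \<le> hamming x y"
    unfolding hamming_def by (rule card_mono[OF fin]) (auto simp: supp_def)
  finally show ?thesis
    using card_Int_Diff[OF assms(1), of "supp y"] card_Int_Diff[OF assms(2), of "supp x"]
    by (simp add: Int_commute)
qed

lemma ex_word_embedding:
  assumes "finite A" "q > 0"
  shows "\<exists>g. (\<forall>x\<in>Hq q (card A) w. g x \<in> words q A w) \<and>
    (\<forall>x\<in>Hq q (card A) w. \<forall>y\<in>Hq q (card A) w. hamming (g x) (g y) = hdist x y)"
proof -
  obtain h where h: "bij_betw h A {..<card A}"
    using ex_bij_betw_finite_nat[OF assms(1)] by (auto simp: atLeast0LessThan)
  define g :: "nat list \<Rightarrow> 'a \<Rightarrow> nat" where "g x = (\<lambda>a. if a \<in> A then x ! h a else 0)" for x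
  have card_pullback: "card {a \<in> A. R (h a)} = card {i. i < card A \<and> R i}" for R
    by (rule bij_betw_same_card[of h], rule bij_betw_subset[OF h]) (use h in \<open>auto simp: bij_betw_def\<close>)
  have "g x \<in> words q A w" if x: "x \<in> Hq q (card A) w" for x
  proof -
    have "supp (g x) = {a \<in> A. x ! h a \<noteq> 0}"
      by (auto simp: supp_def g_def)
    moreover have "card {a \<in> A. x ! h a \<noteq> 0} = w"
      using x card_pullback[of "\<lambda>i. x ! i \<noteq> 0"] by (auto simp: Hq_def wt_def)
    moreover have "g x a < q" for a
    proof (cases "a \<in> A")
      case True
      then have "x ! h a \<in> set x"
        using x h by (auto simp: Hq_def bij_betw_def intro!: nth_mem)
      then show ?thesis
        using x True by (auto simp: Hq_def g_def)
    qed (simp add: g_def \<open>q > 0\<close>)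
    ultimately show ?thesis
      by (auto simp: words_def)
  qed
  moreover have "hamming (g x) (g y) = hdist x y" if "x \<in> Hq q (card A) w" for x y
  proof -
    have "{a. g x a \<noteq> g y a} = {a \<in> A. x ! h a \<noteq> y ! h a}"
      by (auto simp: g_def)
    then show ?thesis
      using that card_pullback[of "\<lambda>i. x ! i \<noteq> y ! i"] by (simp add: hamming_def hdist_def Hq_def)
  qed
  ultimately show ?thesis
    by blast
qed

theorem ex_TOC_of_proper_colouring:
  assumes A: "finite A" and q: "q > 0" and t: "t \<le> w" "w \<le> card A" "2 * (w - t) < d"
    and proper: "proper_colouring d (words q A w) f"
    and colours: "f ` words q A w \<subseteq> K" "finite K"
      "card K \<le> (card A - t choose (w - t)) * (q - 1) ^ (w - t)"
  shows "\<exists>P. is_TOC q (card A) d w P"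
proof -
  obtain g where g: "\<And>x. x \<in> Hq q (card A) w \<Longrightarrow> g x \<in> words q A w"
    and hamming: "\<And>x y. x \<in> Hq q (card A) w \<Longrightarrow> y \<in> Hq q (card A) w \<Longrightarrow> hamming (g x) (g y) = hdist x y"
    using ex_word_embedding[OF A q, of w] by blast
  show ?thesis
  proof (rule is_TOC_of_few_colours[OF q t])
    fix x y
    assume xy: "x \<in> Hq q (card A) w" "y \<in> Hq q (card A) w" "f (g x) = f (g y)" "x \<noteq> y"
    show "d \<le> hdist x y"
    proof (rule ccontr)
      assume "\<not> d \<le> hdist x y"
      then have "g x = g y"
        using proper_colouringD[OF proper g[OF xy(1)] g[OF xy(2)] xy(3)] hamming xy by simp
      then have "hdist x y = 0"
        using hamming[OF xy(1,2)] by (simp add: hamming_def)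
      then have "x = y"
        using xy(1,2) by (auto simp: hdist_def Hq_def intro!: nth_equalityI)
      then show False
        using xy by simp
    qed
  next
    have "(\<lambda>x. f (g x)) ` Hq q (card A) w \<subseteq> K"
      using g colours(1) by blast
    then show "card ((\<lambda>x. f (g x)) ` Hq q (card A) w)
        \<le> (card A - t choose (w - t)) * (q - 1) ^ (w - t)"
      using card_mono[OF colours(2)] colours(3) le_trans by blast
  qed
qed

lemma proper_colouring_refine:
  assumes same_part: "\<And>x y. x \<in> W \<Longrightarrow> y \<in> W \<Longrightarrow> hamming x y < d \<Longrightarrow> f x = f y \<Longrightarrow> part x = part y"
    and local: "\<And>p. p \<in> part ` W \<Longrightarrow> proper_colouring d {x \<in> W. part x = p} (g p)"
  shows "proper_colouring d W (\<lambda>x. (f x, g (part x) x))"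
proof (rule proper_colouringI)
  fix x y
  assume "x \<in> W" "y \<in> W" "(f x, g (part x) x) = (f y, g (part y) y)" "hamming x y < d"
  then show "x = y"
    using same_part[of x y] proper_colouringD[OF local[of "part x"], of x y] by auto
qed

lemma proper_colouring_if:
  assumes "proper_colouring d {x \<in> W. P x} f" "proper_colouring d {x \<in> W. \<not> P x} g"
    and "\<And>x y. x \<in> W \<Longrightarrow> y \<in> W \<Longrightarrow> P x \<Longrightarrow> \<not> P y \<Longrightarrow> hamming x y < d \<Longrightarrow> f x \<noteq> g y"
  shows "proper_colouring d W (\<lambda>x. if P x then f x else g x)"
proof (rule proper_colouringI)
  fix x y
  assume xy: "x \<in> W" "y \<in> W" "(if P x then f x else g x) = (if P y then f y else g y)"
    "hamming x y < d"
  moreover have "hamming y x = hamming x y"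
    by (simp add: hamming_def eq_commute)
  ultimately show "x = y"
    using assms(3)[of x y] assms(3)[of y x]
      proper_colouringD[OF assms(1), of x y] proper_colouringD[OF assms(2), of x y]
    by (auto split: if_splits)
qed

section \<open>Words on four points\<close>

definition tetracode :: "nat \<Rightarrow> nat \<Rightarrow> nat \<Rightarrow> nat \<Rightarrow> bool" where
  "tetracode a b c d \<longleftrightarrow> a < 3 \<and> b < 3 \<and> c = (a + b) mod 3 \<and> d = (a + c) mod 3"

lemma tetracode_unique:
  assumes "tetracode a b c d" "tetracode a' b' c' d'"
    and "a = a' \<and> b = b' \<or> a = a' \<and> c = c' \<or> a = a' \<and> d = d' \<or>
      b = b' \<and> c = c' \<or> b = b' \<and> d = d' \<or> c = c' \<and> d = d'"
  shows "a = a' \<and> b = b' \<and> c = c' \<and> d = d'"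
proof -
  have "a \<in> {0, 1, 2}" "b \<in> {0, 1, 2}" "a' \<in> {0, 1, 2}" "b' \<in> {0, 1, 2}"
    using assms(1,2) by (auto simp: tetracode_def)
  then show ?thesis
    using assms unfolding tetracode_def by (elim insertE emptyE; simp)
qed

definition flip :: "bool \<Rightarrow> nat \<Rightarrow> nat" where
  "flip e a = (if e then 2 * a mod 3 else a)"

lemma flip_eq_iff:
  assumes "a < 3" "b < 3"
  shows "flip e a = flip e b \<longleftrightarrow> a = b"
proof -
  have "a \<in> {0, 1, 2}" "b \<in> {0, 1, 2}"
    using assms by auto
  then show ?thesis
    by (elim insertE emptyE; simp add: flip_def)
qed

text \<open>The sign changes of the last three places with an even number of signs map the tetracode to four
  codes that partition the words of weight 3.\<close>

definition signed_tetracode :: "bool \<times> bool \<Rightarrow> nat \<Rightarrow> nat \<Rightarrow> nat \<Rightarrow> nat \<Rightarrow> bool" where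
  "signed_tetracode e a b c d \<longleftrightarrow>
    tetracode a (flip (fst e) b) (flip (snd e) c) (flip (fst e \<noteq> snd e) d)"

lemma ex_signed_tetracode:
  assumes "a < 3" "b < 3" "c < 3" "d < 3"
    and "a = 0 \<and> b \<noteq> 0 \<and> c \<noteq> 0 \<and> d \<noteq> 0 \<or> a \<noteq> 0 \<and> b = 0 \<and> c \<noteq> 0 \<and> d \<noteq> 0 \<or>
      a \<noteq> 0 \<and> b \<noteq> 0 \<and> c = 0 \<and> d \<noteq> 0 \<or> a \<noteq> 0 \<and> b \<noteq> 0 \<and> c \<noteq> 0 \<and> d = 0"
  shows "\<exists>e. signed_tetracode e a b c d"
proof -
  have "a \<in> {0, 1, 2}" "b \<in> {0, 1, 2}" "c \<in> {0, 1, 2}" "d \<in> {0, 1, 2}"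
    using assms(1-4) by auto
  then show ?thesis
    using assms(5)
    by (elim insertE emptyE;
        simp add: signed_tetracode_def tetracode_def flip_def split_paired_Ex ex_bool_eq)
qed

lemma supp_word_on_four_points:
  assumes x: "x \<in> words q Q 3" and Q: "card Q = 4"
  obtains z where "z \<in> Q" "\<And>a. a \<in> Q \<Longrightarrow> x a = 0 \<longleftrightarrow> a = z"
proof -
  have "card (Q - supp x) = 1"
    using in_wordsD(1,2)[OF x] Q finite_supp_word[OF x] by (simp add: card_Diff_subset)
  then obtain z where "Q - supp x = {z}"
    by (auto simp: card_1_singleton_iff)
  then show thesis
    using that[of z] unfolding supp_def by blast
qed

lemma agree_on_four_points:
  assumes x: "x \<in> words q Q w" and y: "y \<in> words q Q w"
    and Q: "card Q = 4" and near: "hamming x y < 3"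
  obtains a b where "a \<in> Q" "b \<in> Q" "a \<noteq> b" "x a = y a" "x b = y b"
proof -
  let ?D = "{a. x a \<noteq> y a}"
  have "?D \<subseteq> Q"
    using word_eq_0_outside[OF x] word_eq_0_outside[OF y]
    by (metis (mono_tags) mem_Collect_eq subsetI)
  moreover have "finite Q"
    using Q card_ge_0_finite by force
  ultimately have "card (Q - ?D) > 1"
    using near Q by (simp add: card_Diff_subset finite_subset hamming_def)
  then obtain a b where "a \<in> Q - ?D" "b \<in> Q - ?D" "a \<noteq> b"
    using \<open>finite Q\<close> card_le_Suc0_iff_eq[of "Q - ?D"] by (auto simp: not_le[symmetric])
  then show thesis
    using that[of a b] by blast
qed

lemma ex_proper_colouring_four_points:
  assumes Q: "card Q = 4"
  shows "\<exists>f :: ('a \<Rightarrow> nat) \<Rightarrow> bool \<times> bool. proper_colouring 3 (words 3 Q 3) f"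
proof -
  obtain points where "set points = Q" "distinct points" "length points = 4"
    using Q by (metis card_ge_0_finite distinct_card finite_distinct_list zero_less_numeral)
  then obtain p q r s where pqrs: "Q = {p, q, r, s}" "distinct [p, q, r, s]"
    by (auto simp: numeral_eq_Suc length_Suc_conv)
  define f where "f x = (SOME e. signed_tetracode e (x p) (x q) (x r) (x s))" for x :: "'a \<Rightarrow> nat"
  have coded: "signed_tetracode (f x) (x p) (x q) (x r) (x s)" if x: "x \<in> words 3 Q 3" for x
  proof -
    obtain z where "z \<in> Q" "\<And>a. a \<in> Q \<Longrightarrow> x a = 0 \<longleftrightarrow> a = z"
      using supp_word_on_four_points[OF x Q] by blast
    then have "\<exists>e. signed_tetracode e (x p) (x q) (x r) (x s)"
      using pqrs in_wordsD(3)[OF x] by (intro ex_signed_tetracode) auto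
    then show ?thesis
      unfolding f_def by (rule someI_ex)
  qed
  have "proper_colouring 3 (words 3 Q 3) f"
  proof (rule proper_colouringI)
    fix x y
    assume x: "x \<in> words 3 Q 3" and y: "y \<in> words 3 Q 3"
      and eq: "f x = f y" and near: "hamming x y < 3"
    obtain a b where ab: "a \<in> Q" "b \<in> Q" "a \<noteq> b" "x a = y a" "x b = y b"
      using agree_on_four_points[OF x y Q near] .
    have flip_eq: "flip e (x c) = flip e (y c) \<longleftrightarrow> x c = y c" for e c
      using in_wordsD(3)[OF x] in_wordsD(3)[OF y] by (rule flip_eq_iff)
    have "x p = y p \<and> x q = y q \<or> x p = y p \<and> x r = y r \<or> x p = y p \<and> x s = y s \<or>
        x q = y q \<and> x r = y r \<or> x q = y q \<and> x s = y s \<or> x r = y r \<and> x s = y s"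
      using ab unfolding pqrs(1) by (elim insertE emptyE) simp_all
    then have "x p = y p \<and> x q = y q \<and> x r = y r \<and> x s = y s"
      using tetracode_unique[OF coded[OF x, unfolded signed_tetracode_def]
          coded[OF y, folded eq, unfolded signed_tetracode_def]]
      unfolding flip_eq by blast
    then have "x a = y a" if "a \<in> Q" for a
      using that pqrs(1) by auto
    moreover have "x a = y a" if "a \<notin> Q" for a
      using that word_eq_0_outside[OF x] word_eq_0_outside[OF y] by simp
    ultimately show "x = y"
      by blast
  qed
  then show ?thesis
    by blast
qed

section \<open>Resolved block systems\<close>

text \<open>If the blocks form a Steiner quadruple system, then this says that each of the classes of blocks
  with equal \<^term>\<open>cls b\<close> is a partial \<open>S(2,4,v)\<close>.\<close>

definition resolved :: "'a set set \<Rightarrow> ('a set \<Rightarrow> 'c) \<Rightarrow> bool" where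
  "resolved B cls \<longleftrightarrow> (\<forall>b\<in>B. card b = 4) \<and>
    (\<forall>b\<in>B. \<forall>c\<in>B. \<forall>x y. cls b = cls c \<longrightarrow> x \<noteq> y \<longrightarrow> {x, y} \<subseteq> b \<inter> c \<longrightarrow> b = c)"

lemma resolved_card: "resolved B cls \<Longrightarrow> b \<in> B \<Longrightarrow> card b = 4"
  by (simp add: resolved_def)

lemma resolved_eqD:
  "resolved B cls \<Longrightarrow> b \<in> B \<Longrightarrow> c \<in> B \<Longrightarrow> cls b = cls c \<Longrightarrow> x \<noteq> y \<Longrightarrow> {x, y} \<subseteq> b \<inter> c \<Longrightarrow> b = c"
  unfolding resolved_def by blast

definition block_of :: "'a set set \<Rightarrow> 'a set \<Rightarrow> 'a set" where
  "block_of B T = (SOME b. b \<in> B \<and> T \<subseteq> b)"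

lemma block_of:
  assumes "\<exists>b\<in>B. T \<subseteq> b"
  shows "block_of B T \<in> B" "T \<subseteq> block_of B T"
  using someI_ex[of "\<lambda>b. b \<in> B \<and> T \<subseteq> b"] assms unfolding block_of_def by blast+

lemma near_words_common_points:
  assumes x: "x \<in> words q A 3" and y: "y \<in> words q A 3" and near: "hamming x y < 3"
  obtains a b where "a \<noteq> b" "{a, b} \<subseteq> supp x \<inter> supp y"
proof -
  have fin: "finite (supp x)" "finite (supp y)"
    using finite_supp_word[OF x] finite_supp_word[OF y] by simp_all
  have "2 * card (supp x \<inter> supp y) + hamming x y \<ge> 6"
    using card_supp_add_le[OF fin] in_wordsD(2)[OF x] in_wordsD(2)[OF y] by simp
  then have "card (supp x \<inter> supp y) > 1"
    using near by linarith
  then show thesis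
    using that fin card_le_Suc0_iff_eq[of "supp x \<inter> supp y"] by (auto simp: not_le[symmetric])
qed

lemma ex_proper_colouring_resolved:
  fixes A :: "'a set" and cls :: "'a set \<Rightarrow> 'c"
  assumes resolved: "resolved B cls"
  defines "W \<equiv> {x \<in> words 3 A 3. \<exists>b\<in>B. supp x \<subseteq> b}"
  shows "\<exists>g. proper_colouring 3 W (\<lambda>x. (cls (block_of B (supp x)), g x :: bool \<times> bool))"
proof -
  obtain g :: "'a set \<Rightarrow> ('a \<Rightarrow> nat) \<Rightarrow> bool \<times> bool"
    where g: "\<And>Q. card Q = 4 \<Longrightarrow> proper_colouring 3 (words 3 Q 3) (g Q)"
    using ex_proper_colouring_four_points by metis
  have "proper_colouring 3 W (\<lambda>x. (cls (block_of B (supp x)), g (block_of B (supp x)) x))"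
  proof (rule proper_colouring_refine[where part = "\<lambda>x. block_of B (supp x)"])
    fix x y
    assume xy: "x \<in> W" "y \<in> W" "hamming x y < 3"
      "cls (block_of B (supp x)) = cls (block_of B (supp y))"
    then have words: "x \<in> words 3 A 3" "y \<in> words 3 A 3"
      by (auto simp: W_def)
    obtain a b where "a \<noteq> b" "{a, b} \<subseteq> supp x \<inter> supp y"
      using near_words_common_points[OF words xy(3)] .
    then show "block_of B (supp x) = block_of B (supp y)"
      using xy block_of[of B "supp x"] block_of[of B "supp y"]
      by (intro resolved_eqD[OF resolved, of _ _ a b]) (auto simp: W_def)
  next
    fix Q
    assume "Q \<in> (\<lambda>x. block_of B (supp x)) ` W"
    then have "card Q = 4"
      using block_of(1) resolved_card[OF resolved] by (auto simp: W_def)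
    moreover have "{x \<in> W. block_of B (supp x) = Q} \<subseteq> words 3 Q 3"
      using block_of(2) by (auto simp: W_def words_def)
    ultimately show "proper_colouring 3 {x \<in> W. block_of B (supp x) = Q} (g Q)"
      using g[of Q] unfolding proper_colouring_def by blast
  qed
  then show ?thesis
    by (rule exI[where x = "\<lambda>x. g (block_of B (supp x)) x"])
qed

section \<open>Baker's resolution of the planes of an affine space of order 2\<close>

locale boolean_group =
  fixes G :: "'a::ab_group_add set"
  assumes add_self [simp]: "(x::'a) + x = 0"
    and add_closed: "x \<in> G \<Longrightarrow> y \<in> G \<Longrightarrow> x + y \<in> G"
begin

lemma add_self_left [simp]: "(x::'a) + (x + y) = y"
  by (simp flip: add.assoc)

lemma add_eq_0_iff_eq [simp]: "(x::'a) + y = 0 \<longleftrightarrow> x = y"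
  by (metis add_self add_left_cancel)

definition planes :: "'a set set" where
  "planes = {b. b \<subseteq> G \<and> card b = 4 \<and> \<Sum>b = 0}"

definition directions :: "'a set \<Rightarrow> 'a set" where
  "directions b = {x + y |x y. x \<in> b \<and> y \<in> b \<and> x \<noteq> y}"

lemma plane_through:
  assumes b: "b \<in> planes" and xy: "x \<in> b" "y \<in> b" "x \<noteq> y"
  obtains z where "z \<in> b" "z \<noteq> x" "z \<noteq> y" "b = {x, y, z, x + y + z}"
proof -
  have b_card: "card b = 4" "\<Sum>b = 0"
    using b by (auto simp: planes_def)
  then have "card (b - {x, y}) = 2"
    using xy by (simp add: card_Diff_subset)
  then obtain z t where zt: "b - {x, y} = {z, t}" "z \<noteq> t"
    by (auto simp: card_2_iff)
  then have b_eq: "b = {x, y, z, t}" and distinct: "z \<notin> {x, y}" "t \<notin> {x, y}"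
    using xy by auto
  have "x \<notin> {y, z, t}" "y \<notin> {z, t}" "z \<notin> {t}"
    using xy(3) zt(2) distinct by auto
  then have "x + (y + (z + t)) = 0"
    using b_card(2) unfolding b_eq by (simp del: add_eq_0_iff_eq)
  moreover have "x + y + z = (x + (y + (z + t))) + t"
    by (simp add: add.assoc)
  ultimately have "t = x + y + z"
    by simp
  then show thesis
    using that[of z] b_eq distinct by auto
qed

lemma directions_plane:
  assumes "x \<noteq> y" "x \<noteq> z" "y \<noteq> z"
  shows "directions {x, y, z, x + y + z} = {x + y, x + z, (x + y) + (x + z)}"
proof -
  let ?b = "{x, y, z, x + y + z}"
  have third: "(x + y) + (x + z) = y + z"
    by (simp add: ac_simps)
  have "directions ?b \<subseteq> {x + y, x + z, y + z}"
    by (auto simp: directions_def ac_simps)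
  moreover have "{x + y, x + z, y + z} \<subseteq> directions ?b"
    using assms unfolding directions_def by blast
  ultimately show ?thesis
    unfolding third by simp
qed

lemma ex_plane:
  assumes T: "T \<subseteq> G" "card T = 3"
  shows "\<exists>b\<in>planes. T \<subseteq> b"
proof -
  obtain x y z where xyz: "T = {x, y, z}" "x \<noteq> y" "x \<noteq> z" "y \<noteq> z"
    using T(2) by (auto simp: card_3_iff)
  have "u + (v + w) \<noteq> u" if "v \<noteq> w" for u v w :: 'a
    using that by (metis add_eq_0_iff_eq add.right_neutral add_left_cancel)
  then have "x + y + z \<notin> T"
    using xyz by (metis add.assoc add.commute insertE singletonD)
  then have "insert (x + y + z) T \<in> planes"
    using T xyz add_closed by (auto simp: planes_def ac_simps)
  then show ?thesis
    by blast
qed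

lemma resolved_planes:
  assumes packing: "\<And>u v v'. u \<in> G - {0} \<Longrightarrow> v \<in> G - {0, u} \<Longrightarrow> v' \<in> G - {0, u} \<Longrightarrow>
    colour {u, v, u + v} = colour {u, v', u + v'} \<Longrightarrow> v' = v \<or> v' = u + v"
  shows "resolved planes (\<lambda>b. colour (directions b))"
  unfolding resolved_def
proof (intro conjI ballI allI impI)
  show "card b = 4" if "b \<in> planes" for b
    using that by (simp add: planes_def)
next
  fix b c x y
  assume bc: "b \<in> planes" "c \<in> planes" "colour (directions b) = colour (directions c)"
    and xy: "x \<noteq> y" "{x, y} \<subseteq> b \<inter> c"
  obtain z where z: "z \<in> b" "z \<noteq> x" "z \<noteq> y" "b = {x, y, z, x + y + z}"
    using plane_through[OF bc(1), of x y] xy by auto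
  obtain t where t: "t \<in> c" "t \<noteq> x" "t \<noteq> y" "c = {x, y, t, x + y + t}"
    using plane_through[OF bc(2), of x y] xy by auto
  have "colour {x + y, x + z, (x + y) + (x + z)} = colour {x + y, x + t, (x + y) + (x + t)}"
    using bc(3) directions_plane[of x y z] directions_plane[of x y t] z t xy(1) by metis
  moreover have "b \<subseteq> G" "c \<subseteq> G"
    using bc by (auto simp: planes_def)
  ultimately have "x + t = x + z \<or> x + t = (x + y) + (x + z)"
    using z t xy by (intro packing) (auto simp: add_closed subset_iff)
  then have "t = z \<or> t = x + y + z"
    by (auto simp: add.assoc)
  then show "b = c"
    unfolding z(4) t(4) by auto
qed

end

locale cubing_field =
  fixes F :: "'f::field set"
  assumes finite_F: "finite F"
    and zero_F: "0 \<in> F"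
    and add_F: "x \<in> F \<Longrightarrow> y \<in> F \<Longrightarrow> x + y \<in> F"
    and mult_F: "x \<in> F \<Longrightarrow> y \<in> F \<Longrightarrow> x * y \<in> F"
    and char_2: "(1::'f) + 1 = 0"
    and inj_on_cube: "inj_on (\<lambda>x. x ^ 3) F"
begin

lemma two_eq_0 [simp]: "(2::'f) = 0"
  using char_2 by simp

sublocale scalars: boolean_group F
proof
  show "x + x = 0" for x :: 'f
    using distrib_left[of x 1 1] by (simp add: char_2 del: one_add_one)
qed (rule add_F)

sublocale boolean_group "F \<times> (UNIV :: bit set)"
proof
  show "u + u = 0" for u :: "'f \<times> bit"
    by (cases u) (simp add: zero_prod_def)
  show "u + v \<in> F \<times> UNIV" if "u \<in> F \<times> UNIV" "v \<in> F \<times> UNIV" for u v :: "'f \<times> bit"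
    using that add_F by (cases u; cases v) auto
qed

lemma cube_eq_iff: "x \<in> F \<Longrightarrow> y \<in> F \<Longrightarrow> x ^ 3 = y ^ 3 \<longleftrightarrow> x = y"
  using inj_on_cube by (auto simp: inj_on_def)

lemma bij_betw_cube: "bij_betw (\<lambda>x. x ^ 3) (F - {0}) (F - {0})"
proof -
  have "inj_on (\<lambda>x. x ^ 3) (F - {0})"
    using inj_on_cube by (rule inj_on_subset) blast
  moreover have "(\<lambda>x. x ^ 3) ` (F - {0}) \<subseteq> F - {0}"
    using mult_F by (auto simp: power3_eq_cube)
  ultimately show ?thesis
    using finite_F by (simp add: bij_betw_def endo_inj_surj)
qed

lemma cube_add: "((x::'f) + y) ^ 3 = x ^ 3 + y ^ 3 + x * y * (x + y)"
proof -
  have "(x + y) ^ 3 = x ^ 3 + y ^ 3 + x * y * (x + y) + (x * y * (x + y) + x * y * (x + y))"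
    by (simp add: power3_eq_cube algebra_simps del: scalars.add_self scalars.add_self_left)
  then show ?thesis
    by simp
qed

lemma norm_form_nonzero:
  assumes "x \<in> F" "y \<in> F" "y \<noteq> 0"
  shows "x\<^sup>2 + x * y + y\<^sup>2 \<noteq> 0"
proof
  assume norm_0: "x\<^sup>2 + x * y + y\<^sup>2 = 0"
  have "x ^ 3 - y ^ 3 = (x - y) * (x\<^sup>2 + x * y + y\<^sup>2)"
    by (simp add: algebra_simps power2_eq_square power3_eq_cube
        del: scalars.add_self scalars.add_self_left)
  then have "x = y"
    using norm_0 cube_eq_iff[OF assms(1,2)] by simp
  then show False
    using norm_0 assms(3) by (simp add: power2_eq_square)
qed

text \<open>Baker's packing of the lines of a projective space over the field of order 2 into spreads: a line
  \<open>{(x,0), (y,0), (x+y,0)}\<close> gets the colour \<open>x^3 + y^3 + (x+y)^3\<close>, a line \<open>{(x,1), (y,1), (x+y,0)}\<close> the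
  colour \<open>x^3 + y^3\<close>. The form computes these colours from any two points of the line.\<close>

definition line_form :: "'f \<times> bit \<Rightarrow> 'f \<times> bit \<Rightarrow> 'f" where
  "line_form u v = (case (u, v) of ((x, a), (y, b)) \<Rightarrow>
    x * y * (x + y) + ((if a = 1 then y else 0) + (if b = 1 then x else 0)) ^ 3)"

definition line_colour :: "('f \<times> bit) set \<Rightarrow> 'f" where
  "line_colour l = (\<Sum>u\<in>l. if snd u = 1 \<or> (\<forall>v\<in>l. snd v = 0) then fst u ^ 3 else 0)"

lemma line_colour_eq_form:
  assumes "u \<noteq> 0" "v \<noteq> 0" "u \<noteq> v"
  shows "line_colour {u, v, u + v} = line_form u v"
proof -
  obtain x a y b where coords: "u = (x, a)" "v = (y, b)"
    by (cases u; cases v)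
  then show ?thesis
    using assms
    by (cases a; cases b) (auto simp: line_colour_def line_form_def zero_prod_def cube_add ac_simps)
qed

lemma line_form_eqD_0:
  assumes F: "x \<in> F" "y \<in> F" "y' \<in> F" and x: "x \<noteq> 0"
    and eq: "line_form (x, 0) (y, b) = line_form (x, 0) (y', b')"
  shows "b' = b \<and> (y' = y \<or> y' = x + y)"
proof -
  have factor: "line_form (x, 0) (z, c) = x * (z\<^sup>2 + z * x + (if c = 1 then x\<^sup>2 else 0))" for z c
    by (simp add: line_form_def power2_eq_square power3_eq_cube algebra_simps)
  have "y\<^sup>2 + y * x + (if b = 1 then x\<^sup>2 else 0) = y'\<^sup>2 + y' * x + (if b' = 1 then x\<^sup>2 else 0)"
    using eq x by (simp add: factor)
  moreover define s where "s = y + y'"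
  then have y': "y' = y + s"
    by simp
  then have "y'\<^sup>2 + y' * x = (y\<^sup>2 + y * x) + (s\<^sup>2 + s * x)"
    by (simp add: power2_sum algebra_simps)
  ultimately have kernel: "s\<^sup>2 + s * x + (if b = b' then 0 else x\<^sup>2) = 0"
    by (cases b; cases b') (simp_all add: add.assoc)
  then have "b = b'"
    using norm_form_nonzero[of s x] F add_F x by (auto simp: s_def split: if_splits)
  then have "s * (s + x) = 0"
    using kernel by (simp add: power2_eq_square distrib_left)
  then have "s = 0 \<or> s = x"
    by (simp only: mult_eq_0_iff scalars.add_eq_0_iff_eq)
  then show ?thesis
    using \<open>b = b'\<close> y' by (auto simp: add.commute)
qed

lemma line_form_eqD_1:
  assumes F: "x \<in> F" "y \<in> F" "y' \<in> F"
    and eq: "line_form (x, 1) (y, b) = line_form (x, 1) (y', b')"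
  shows "if b' = b then y' = y else y' = x + y"
proof -
  have cubes: "line_form (x, 1) (z, c) = x ^ 3 + (if c = 1 then z else x + z) ^ 3" for z c
    by (simp add: line_form_def cube_add ac_simps)
  then have "(if b = 1 then y else x + y) = (if b' = 1 then y' else x + y')"
    using eq F cube_eq_iff by (simp add: add_F split: if_splits)
  then show ?thesis
    by (cases b; cases b') auto
qed

lemma line_form_eqD:
  assumes u: "u \<in> F \<times> UNIV" "u \<noteq> 0" and v: "v \<in> F \<times> UNIV" and v': "v' \<in> F \<times> UNIV"
    and eq: "line_form u v = line_form u v'"
  shows "v' = v \<or> v' = u + v"
proof -
  obtain x a y b y' b' where coords: "u = (x, a)" "v = (y, b)" "v' = (y', b')"
    by (cases u; cases v; cases v')
  then have F: "x \<in> F" "y \<in> F" "y' \<in> F"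
    using u v v' by auto
  consider "a = 0" | "a = 1"
    by (cases a)
  then show ?thesis
  proof cases
    assume "a = 0"
    then have "x \<noteq> 0"
      using u(2) coords(1) by (auto simp: zero_prod_def)
    then show ?thesis
      using line_form_eqD_0[OF F] eq coords \<open>a = 0\<close> by auto
  next
    assume "a = 1"
    then show ?thesis
      using line_form_eqD_1[OF F] eq coords by (cases b; cases b') fastforce+
  qed
qed

lemma line_form_nonzero:
  assumes "u \<in> F \<times> UNIV" "v \<in> F \<times> UNIV" "u \<noteq> 0" "v \<noteq> 0" "u \<noteq> v"
  shows "line_form u v \<in> F - {0}"
proof -
  have "line_form u 0 = 0"
    by (cases u) (simp add: line_form_def zero_prod_def)
  then have "line_form u v \<noteq> 0"
    using line_form_eqD[of u 0 v] line_form_eqD[of u v 0] assms zero_F by (auto simp: zero_prod_def)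
  moreover have "line_form u v \<in> F"
    using assms zero_F add_F mult_F by (auto simp: line_form_def power3_eq_cube)
  ultimately show ?thesis
    by simp
qed

definition plane_colour :: "('f \<times> bit) set \<Rightarrow> 'f" where
  "plane_colour b = line_colour (directions b)"

lemma resolved_planes_colour: "resolved planes plane_colour"
  unfolding plane_colour_def
proof (rule resolved_planes)
  fix u v v'
  assume points: "u \<in> F \<times> UNIV - {0}" "v \<in> F \<times> UNIV - {0, u}" "v' \<in> F \<times> UNIV - {0, u}"
    and "line_colour {u, v, u + v} = line_colour {u, v', u + v'}"
  then have "line_form u v = line_form u v'"
    using line_colour_eq_form[of u v] line_colour_eq_form[of u v'] by (metis DiffD2 insertCI)
  then show "v' = v \<or> v' = u + v"
    using points by (intro line_form_eqD) blast+
qed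

lemma plane_colour_nonzero:
  assumes "b \<in> planes"
  shows "plane_colour b \<in> F - {0}"
proof -
  have "b \<subseteq> F \<times> UNIV" "card b = 4"
    using assms by (auto simp: planes_def)
  then obtain x y where xy: "x \<in> b" "y \<in> b" "x \<noteq> y"
    using card_le_Suc0_iff_eq[of b] card_ge_0_finite[of b] by auto
  obtain z where z: "z \<in> b" "z \<noteq> x" "z \<noteq> y" "b = {x, y, z, x + y + z}"
    using plane_through[OF assms xy] .
  have "line_form (x + y) (x + z) \<in> F - {0}"
    using xy z \<open>b \<subseteq> F \<times> UNIV\<close> by (intro line_form_nonzero add_closed) auto
  then show ?thesis
    using directions_plane[of x y z] xy z by (simp add: plane_colour_def line_colour_eq_form)
qed

lemma plane_colour_fibre:
  assumes "d \<in> F - {0}"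
  shows "{0, d} \<times> UNIV \<in> planes" "plane_colour ({0, d} \<times> UNIV) = d ^ 3"
proof -
  have UNIV_bit: "(UNIV :: bit set) = {0, 1}"
    by (auto intro: bit.exhaust)
  have fibre: "{0, d} \<times> (UNIV :: bit set) = {(0, 0), (0, 1), (d, 0), (0, 0) + (0, 1) + (d, 0)}"
    by (auto simp: UNIV_bit)
  have "{0, d} \<times> (UNIV :: bit set) \<subseteq> F \<times> UNIV"
    using assms zero_F by auto
  then show "{0, d} \<times> UNIV \<in> planes"
    using assms by (simp add: planes_def fibre zero_prod_def)
  have "directions ({0, d} \<times> UNIV) = {(0, 1), (d, 0), (0, 1) + (d, 0)}"
    unfolding fibre using assms by (subst directions_plane) auto
  then show "plane_colour ({0, d} \<times> UNIV) = d ^ 3"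
    using assms line_colour_eq_form[of "(0, 1)" "(d, 0)"]
    by (simp add: plane_colour_def line_form_def zero_prod_def)
qed

end

lemma rsquarefree_of_pderiv_nonzero:
  fixes p :: "'a::idom poly"
  assumes simple: "\<And>x. poly p x = 0 \<Longrightarrow> poly (pderiv p) x \<noteq> 0"
  shows "rsquarefree p"
proof -
  have "p \<noteq> 0"
    using simple by auto
  moreover have "order x p \<le> 1" for x
  proof (rule ccontr)
    assume "\<not> order x p \<le> 1"
    then have "[:-x, 1:] ^ 2 dvd p"
      by (simp add: order_divides)
    then obtain r where "p = [:-x, 1:] ^ 2 * r"
      by (elim dvdE)
    then have p: "p = [:-x, 1:] * ([:-x, 1:] * r)"
      by (simp only: power2_eq_square mult.assoc)
    have "poly (pderiv ([:-x, 1:] * s)) x = poly s x" for s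
      by (simp add: pderiv_mult pderiv_pCons del: mult_pCons_left)
    then have "poly p x = 0 \<and> poly (pderiv p) x = 0"
      unfolding p by simp
    then show False
      using simple by blast
  qed
  ultimately show ?thesis
    by (auto simp: rsquarefree_def le_Suc_eq)
qed

lemma size_proots_alg_closed:
  fixes p :: "'a::alg_closed_field poly"
  shows "size (proots p) = degree p"
proof (cases "p = 0")
  case False
  obtain A where A: "size A = degree p" "p = smult (lead_coeff p) (\<Prod>x\<in>#A. [:-x, 1:])"
    using alg_closed_imp_factorization[OF False] by blast
  have "proots (\<Prod>x\<in>#A. [:-x, 1:]) = A"
  proof (induction A)
    case (add x A)
    have "(\<Prod>x\<in>#A. [:-x, 1:]) \<noteq> 0"
      by (auto simp: prod_mset_zero_iff)
    then show ?case
      using add.IH by (simp add: proots_mult del: mult_pCons_left)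
  qed simp
  then have "proots p = A"
    using False by (subst A(2)) simp
  then show ?thesis
    using A(1) by simp
qed simp

lemma card_roots_rsquarefree:
  fixes p :: "'a::alg_closed_field poly"
  assumes "rsquarefree p"
  shows "card {x. poly p x = 0} = degree p"
proof -
  have "p \<noteq> 0"
    using assms by (simp add: rsquarefree_def)
  have "degree p = (\<Sum>x | poly p x = 0. order x p)"
    using size_proots_alg_closed[of p] \<open>p \<noteq> 0\<close> by (simp add: size_multiset_overloaded_eq)
  also have "\<dots> = (\<Sum>x | poly p x = 0. 1)"
    using assms \<open>p \<noteq> 0\<close> by (intro sum.cong) (auto simp: rsquarefree_root_order)
  finally show ?thesis
    by simp
qed

lemma card_power_fixed_points:
  assumes n: "n > 1" and char: "of_nat n = (0 :: 'a::alg_closed_field)"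
  shows "card {x :: 'a. x ^ n = x} = n"
proof -
  define p :: "'a poly" where "p = monom 1 n - monom 1 1"
  have "pderiv p = - 1"
    using char by (simp add: p_def pderiv_diff pderiv_monom)
  then have "rsquarefree p"
    by (intro rsquarefree_of_pderiv_nonzero) simp
  moreover have "degree p = n"
    unfolding p_def diff_conv_add_uminus using n
    by (subst degree_add_eq_left) (auto simp: degree_monom_eq)
  ultimately show ?thesis
    using card_roots_rsquarefree[of p] by (simp add: p_def poly_monom)
qed

lemma inj_on_cube_power_fixed_points:
  assumes k: "odd k"
  shows "inj_on (\<lambda>x :: 'a::field. x ^ 3) {x. x ^ (2 ^ k) = x}"
proof (rule inj_onI)
  fix x y :: 'a
  assume xy: "x \<in> {x. x ^ (2 ^ k) = x}" "y \<in> {x. x ^ (2 ^ k) = x}" and eq: "x ^ 3 = y ^ 3"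
  obtain j where "k = 2 * j + 1"
    using k by (elim oddE)
  then have "2 * 2 ^ k = (4::nat) ^ Suc j"
    by (simp add: power_mult)
  moreover have "(4::nat) ^ Suc j mod 3 = 1"
    by (subst power_mod[symmetric]) simp
  moreover define e :: nat where "e = 2 * 2 ^ k div 3"
  ultimately have e: "2 * 2 ^ k = 3 * e + 1"
    by (metis mult_div_mod_eq)
  have "z ^ (3 * e) * z = z * z" if "z ^ (2 ^ k) = z" for z :: 'a
  proof -
    have "z ^ (3 * e) * z = z ^ (2 * 2 ^ k)"
      unfolding e by simp
    then show ?thesis
      using that by (simp add: mult_2 power_add)
  qed
  then have "x ^ (3 * e) = x \<or> x = 0" "y ^ (3 * e) = y \<or> y = 0"
    using xy by auto
  moreover have "x ^ (3 * e) = y ^ (3 * e)"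
    by (simp add: power_mult eq)
  moreover have "x = 0 \<longleftrightarrow> y = 0"
    using eq by (metis power_eq_0_iff zero_less_numeral)
  ultimately show "x = y"
    by auto
qed

lemma CHAR_bit: "CHAR(bit) = 2"
proof (rule CHAR_eqI)
  show "2 dvd n" if "of_nat n = (0 :: bit)" for n
    using that by (cases "even n") (auto elim!: oddE)
qed simp

theorem ex_cubing_field:
  assumes k: "odd k"
  shows "\<exists>F :: bit alg_closure set. cubing_field F \<and> card F = 2 ^ k"
proof -
  let ?F = "{x :: bit alg_closure. x ^ (2 ^ k) = x}"
  have CHAR: "CHAR(bit alg_closure) = 2"
    by (simp add: CHAR_bit)
  have "k > 0"
    using k by (rule odd_pos)
  then have "of_nat (2 ^ k) = (0 :: bit alg_closure)"
    by (subst of_nat_eq_0_iff_char_dvd) (simp add: CHAR_bit)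
  moreover have "(2::nat) ^ k > 1"
    using \<open>k > 0\<close> by (intro one_less_power) simp_all
  ultimately have card: "card ?F = 2 ^ k"
    by (intro card_power_fixed_points)
  have "cubing_field ?F"
  proof
    show "finite ?F"
      using card by (intro card_ge_0_finite) simp
    show "(1 :: bit alg_closure) + 1 = 0"
      using of_nat_CHAR[where 'a = "bit alg_closure"] CHAR by simp
    show "0 \<in> ?F"
      by simp
    show "x + y \<in> ?F" if "x \<in> ?F" "y \<in> ?F" for x y
      using that freshmans_dream'[where 'a = "bit alg_closure" and m = "2 ^ k" and n = k]
      by (simp add: CHAR_bit)
    show "x * y \<in> ?F" if "x \<in> ?F" "y \<in> ?F" for x y
      using that by (simp add: power_mult_distrib)
    show "inj_on (\<lambda>x. x ^ 3) ?F"
      by (rule inj_on_cube_power_fixed_points[OF k])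
  qed
  then show ?thesis
    using card by blast
qed

section \<open>Doubled sets\<close>

definition doubled :: "'v set \<Rightarrow> ('v option \<times> bit) set" where
  "doubled L = insert None (Some ` L) \<times> UNIV"

definition shadow :: "('v option \<times> bit) set \<Rightarrow> 'v set" where
  "shadow T = {x. \<exists>b. (Some x, b) \<in> T}"

lemma subset_doubled_iff: "T \<subseteq> doubled L \<longleftrightarrow> shadow T \<subseteq> L"
proof
  assume "shadow T \<subseteq> L"
  then have "(p, b) \<in> doubled L" if "(p, b) \<in> T" for p b
    using that by (cases p) (auto simp: shadow_def doubled_def)
  then show "T \<subseteq> doubled L"
    by auto
qed (auto simp: shadow_def doubled_def)

lemma doubled_Int: "doubled L \<inter> doubled M = doubled (L \<inter> M)"
  by (auto simp: doubled_def)

lemma UNIV_bit: "(UNIV :: bit set) = {0, 1}"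
  by (auto intro: bit.exhaust)

lemma finite_doubled: "finite L \<Longrightarrow> finite (doubled L)"
  by (simp add: doubled_def UNIV_bit)

lemma card_doubled: "finite L \<Longrightarrow> card (doubled L) = 2 * card L + 2"
  by (simp add: doubled_def UNIV_bit card_cartesian_product card_image image_iff)

definition line_resolution ::
  "'v set \<Rightarrow> ('v option \<times> bit) set set \<Rightarrow> (('v option \<times> bit) set \<Rightarrow> 'v) \<Rightarrow> bool" where
  "line_resolution L B cls \<longleftrightarrow> resolved B cls \<and>
    (\<forall>b\<in>B. b \<subseteq> doubled L \<and> cls b \<in> L) \<and>
    (\<forall>T\<subseteq>doubled L. card T = 3 \<longrightarrow> (\<exists>b\<in>B. T \<subseteq> b)) \<and>
    (\<forall>x\<in>L. doubled {x} \<in> B \<and> cls (doubled {x}) = x)"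

lemma line_resolutionD:
  assumes "line_resolution L B cls"
  shows "resolved B cls" "b \<in> B \<Longrightarrow> b \<subseteq> doubled L" "b \<in> B \<Longrightarrow> cls b \<in> L"
    "T \<subseteq> doubled L \<Longrightarrow> card T = 3 \<Longrightarrow> \<exists>b\<in>B. T \<subseteq> b"
    "x \<in> L \<Longrightarrow> doubled {x} \<in> B" "x \<in> L \<Longrightarrow> cls (doubled {x}) = x"
  using assms unfolding line_resolution_def by simp_all

lemma resolved_inv_image:
  assumes resolved: "resolved B cls" and inj: "inj_on g A"
  shows "resolved {b. b \<subseteq> A \<and> g ` b \<in> B} (\<lambda>b. cls (g ` b))"
  unfolding resolved_def
proof (intro conjI ballI allI impI)
  fix b
  assume "b \<in> {b. b \<subseteq> A \<and> g ` b \<in> B}"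
  then show "card b = 4"
    using resolved_card[OF resolved] card_image[OF inj_on_subset[OF inj]] by fastforce
next
  fix b c x y
  assume b: "b \<in> {b. b \<subseteq> A \<and> g ` b \<in> B}" and c: "c \<in> {b. b \<subseteq> A \<and> g ` b \<in> B}"
    and "cls (g ` b) = cls (g ` c)" "x \<noteq> y" "{x, y} \<subseteq> b \<inter> c"
  moreover from this have "g x \<noteq> g y"
    using inj by (auto simp: inj_on_def)
  ultimately have "g ` b = g ` c"
    using resolved_eqD[OF resolved, of "g ` b" "g ` c" "g x" "g y"] by auto
  then show "b = c"
    using b c inj by (auto simp: inj_on_image_eq_iff)
qed

lemma resolved_recolour:
  assumes "resolved B cls" and "inj_on f (cls ` B)"
  shows "resolved B (\<lambda>b. f (cls b))"
  using assms unfolding resolved_def by (simp add: inj_on_eq_iff)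

lemma (in boolean_group) ex_plane_inv_image:
  assumes g: "bij_betw g A G" and T: "T \<subseteq> A" "card T = 3"
  shows "\<exists>b\<subseteq>A. g ` b \<in> planes \<and> T \<subseteq> b"
proof -
  have "g ` T \<subseteq> G" "card (g ` T) = 3"
    using T g card_image[of g T] by (auto simp: bij_betw_def inj_on_subset)
  then obtain b where b: "b \<in> planes" "g ` T \<subseteq> b"
    using ex_plane by blast
  then have "b \<subseteq> g ` A"
    using g by (simp add: planes_def bij_betw_def)
  then have "g ` {p \<in> A. g p \<in> b} = b"
    by auto
  moreover have "T \<subseteq> {p \<in> A. g p \<in> b}"
    using b(2) T(1) by auto
  ultimately show ?thesis
    using b(1) by (intro exI[of _ "{p \<in> A. g p \<in> b}"]) simp
qed

lemma (in cubing_field) ex_coordinates: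
  assumes L: "finite L" "card L + 1 = card F"
  obtains h g where "bij_betw h L (F - {0})" "bij_betw g (doubled L) (F \<times> (UNIV :: bit set))"
    "\<And>x. g ` doubled {x} = {0, h x} \<times> UNIV"
proof -
  have "card L = card (F - {0})"
    using L finite_F zero_F by simp
  then obtain h where h: "bij_betw h L (F - {0})"
    using finite_same_card_bij[OF L(1)] finite_F by blast
  define g where "g = map_prod (case_option 0 h) (id :: bit \<Rightarrow> bit)"
  have "inj_on (case_option 0 h) (insert None (Some ` L))"
    using h by (auto simp: bij_betw_def inj_on_def)
  moreover have "case_option 0 h ` insert None (Some ` L) = F"
    unfolding image_insert image_image using h zero_F by (auto simp: bij_betw_def)
  ultimately have "bij_betw g (doubled L) (F \<times> UNIV)"
    unfolding g_def doubled_def bij_betw_def by (simp add: map_prod_inj_on map_prod_surj_on)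
  moreover have "g ` doubled {x} = {0, h x} \<times> UNIV" for x
    by (force simp: g_def doubled_def)
  ultimately show thesis
    using that h by blast
qed

lemma (in cubing_field) ex_line_resolution:
  assumes L: "finite L" "card L + 1 = card F"
  shows "\<exists>B cls. line_resolution L B cls"
proof -
  obtain h g where h: "bij_betw h L (F - {0})"
    and g: "bij_betw g (doubled L) (F \<times> (UNIV :: bit set))"
    and fibre: "\<And>x. g ` doubled {x} = {0, h x} \<times> UNIV"
    using ex_coordinates[OF L] by metis
  have cubes: "bij_betw (\<lambda>x. h x ^ 3) L (F - {0})"
    using bij_betw_trans[OF h bij_betw_cube] by (simp add: comp_def)
  define B where "B = {b. b \<subseteq> doubled L \<and> g ` b \<in> planes}"
  define cls where "cls b = the_inv_into L (\<lambda>x. h x ^ 3) (plane_colour (g ` b))" for b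
  have cls_bij: "bij_betw (the_inv_into L (\<lambda>x. h x ^ 3)) (F - {0}) L"
    by (rule bij_betw_the_inv_into[OF cubes])
  have resolved: "resolved B (\<lambda>b. plane_colour (g ` b))"
    unfolding B_def by (rule resolved_inv_image[OF resolved_planes_colour bij_betw_imp_inj_on[OF g]])
  have colours: "(\<lambda>b. plane_colour (g ` b)) ` B \<subseteq> F - {0}"
    using plane_colour_nonzero by (auto simp: B_def)
  have "resolved B cls"
    unfolding cls_def
    by (rule resolved_recolour[OF resolved inj_on_subset[OF bij_betw_imp_inj_on[OF cls_bij] colours]])
  moreover have "cls b \<in> L" if "b \<in> B" for b
    using cls_bij colours that unfolding cls_def bij_betw_def by blast
  moreover have "\<exists>b\<in>B. T \<subseteq> b" if "T \<subseteq> doubled L" "card T = 3" for T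
    using ex_plane_inv_image[OF g that] by (auto simp: B_def)
  moreover have "doubled {x} \<in> B \<and> cls (doubled {x}) = x" if "x \<in> L" for x
  proof -
    have "h x \<in> F - {0}"
      using h that by (auto simp: bij_betw_def)
    moreover have "doubled {x} \<subseteq> doubled L"
      using that by (auto simp: doubled_def)
    ultimately show ?thesis
      using plane_colour_fibre[of "h x"] cubes that
      by (simp add: B_def cls_def fibre the_inv_into_f_f[of "\<lambda>x. h x ^ 3"] bij_betw_def)
  qed
  ultimately show ?thesis
    unfolding line_resolution_def B_def by blast
qed

theorem ex_line_resolution:
  fixes L :: "'v set"
  assumes "odd k" "card L + 1 = 2 ^ k"
  shows "\<exists>B cls. line_resolution L B cls"
proof -
  obtain F :: "bit alg_closure set" where F: "cubing_field F" "card F = 2 ^ k"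
    using ex_cubing_field[OF \<open>odd k\<close>] by blast
  have "(2::nat) ^ k > 1"
    using odd_pos[OF \<open>odd k\<close>] by (intro one_less_power) simp_all
  then have "finite L"
    using assms(2) by (intro card_ge_0_finite) simp
  then show ?thesis
    using cubing_field.ex_line_resolution[OF F(1)] F(2) assms(2) by simp
qed

section \<open>Transversal words\<close>

lemma Some_shadow: "Some ` shadow T = fst ` T - {None}"
proof (rule Set.set_eqI)
  fix p
  show "p \<in> Some ` shadow T \<longleftrightarrow> p \<in> fst ` T - {None}"
    by (cases p) (force simp: shadow_def)+
qed

lemma finite_shadow: "finite T \<Longrightarrow> finite (shadow T)"
  using Some_shadow[of T] by (metis finite_Diff finite_imageD finite_imageI inj_Some)

lemma card_shadow_eq: "card (shadow T) = card (fst ` T - {None})"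
  unfolding Some_shadow[symmetric] by (simp add: card_image)

lemma card_shadow_le:
  assumes "finite T"
  shows "card (shadow T) \<le> card T"
proof -
  have "card (fst ` T - {None}) \<le> card (fst ` T)"
    using assms by (intro card_mono) auto
  also have "\<dots> \<le> card T"
    using assms by (rule card_image_le)
  finally show ?thesis
    by (simp add: card_shadow_eq)
qed

lemma transversal_if_card_shadow:
  assumes T: "finite T" "card (shadow T) = card T"
  shows "inj_on fst T" "(None, b) \<notin> T"
proof -
  have "card T \<le> card (fst ` T - {None})"
    using T(2) by (simp add: card_shadow_eq)
  also have "\<dots> \<le> card (fst ` T)"
    using T(1) by (intro card_mono) auto
  finally have "card (fst ` T) = card T"
    using card_image_le[OF T(1), of fst] by simp
  then show "inj_on fst T"
    using T(1) by (intro eq_card_imp_inj_on)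
  show "(None, b) \<notin> T"
  proof
    assume "(None, b) \<in> T"
    then have "None \<in> fst ` T"
      by force
    then have "card (fst ` T - {None}) < card (fst ` T)"
      using T(1) by (intro card_Diff1_less) auto
    then show False
      using T card_image_le[OF T(1), of fst] by (simp add: card_shadow_eq)
  qed
qed

definition transversal_words :: "'v set \<Rightarrow> ('v option \<times> bit \<Rightarrow> nat) set" where
  "transversal_words N =
    {w. finite (supp w) \<and> card (supp w) = card N \<and> shadow (supp w) = N \<and> (\<forall>p. w p < 3)}"

lemma transversal_wordD:
  assumes "w \<in> transversal_words N"
  shows "inj_on fst (supp w)" "(None, b) \<notin> supp w" "shadow (supp w) = N" "w p < 3"
proof -
  have w: "finite (supp w)" "card (shadow (supp w)) = card (supp w)" "shadow (supp w) = N"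
    "\<forall>p. w p < 3"
    using assms unfolding transversal_words_def by simp_all
  show "inj_on fst (supp w)" "(None, b) \<notin> supp w"
    using transversal_if_card_shadow[OF w(1,2)] by blast+
  show "shadow (supp w) = N" "w p < 3"
    using w(3,4) by blast+
qed

lemma transversal_word_outside:
  assumes w: "w \<in> transversal_words N" and p: "fst p \<notin> Some ` N"
  shows "w p = 0"
proof -
  have "p \<notin> supp w"
  proof
    assume "p \<in> supp w"
    then obtain x where "(Some x, snd p) \<in> supp w" "fst p = Some x"
      using transversal_wordD(2)[OF w] by (cases p; cases "fst p") auto
    then show False
      using p transversal_wordD(3)[OF w] by (auto simp: shadow_def)
  qed
  then show ?thesis
    by (simp add: supp_def)
qed

lemma transversal_word_one_level:
  assumes w: "w \<in> transversal_words N" and x: "x \<in> N"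
  shows "w (Some x, 0) = 0 \<longleftrightarrow> w (Some x, 1) \<noteq> 0"
proof -
  obtain b where "(Some x, b) \<in> supp w"
    using x transversal_wordD(3)[OF w] by (auto simp: shadow_def)
  then have "w (Some x, 0) \<noteq> 0 \<or> w (Some x, 1) \<noteq> 0"
    by (cases b) (auto simp: supp_def)
  moreover have "\<not> (w (Some x, 0) \<noteq> 0 \<and> w (Some x, 1) \<noteq> 0)"
    using inj_onD[OF transversal_wordD(1)[OF w], of "(Some x, 0)" "(Some x, 1)"]
    by (auto simp: supp_def)
  ultimately show ?thesis
    by blast
qed

definition level :: "('v option \<times> bit \<Rightarrow> nat) \<Rightarrow> 'v \<Rightarrow> bool" where
  "level w x \<longleftrightarrow> w (Some x, 1) \<noteq> 0"

definition negative :: "('v option \<times> bit \<Rightarrow> nat) \<Rightarrow> 'v \<Rightarrow> bool" where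
  "negative w x \<longleftrightarrow> w (Some x, 0) = 2 \<or> w (Some x, 1) = 2"

definition column_distance :: "('v option \<times> bit \<Rightarrow> nat) \<Rightarrow> ('v option \<times> bit \<Rightarrow> nat) \<Rightarrow> 'v \<Rightarrow> nat" where
  "column_distance v w x =
    of_bool (v (Some x, 0) \<noteq> w (Some x, 0)) + of_bool (v (Some x, 1) \<noteq> w (Some x, 1))"

lemma column_distance_eq:
  assumes v: "v \<in> transversal_words N" and w: "w \<in> transversal_words N" and x: "x \<in> N"
  shows "column_distance v w x =
    (if level v x \<noteq> level w x then 2 else if negative v x \<noteq> negative w x then 1 else 0)"
proof -
  have "u \<in> {0, 1, 2}" if "u < 3" for u :: nat
    using that by auto
  then have entries: "v p \<in> {0, 1, 2}" "w p \<in> {0, 1, 2}" for p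
    using transversal_wordD(4) v w by metis+
  show ?thesis
    using entries[of "(Some x, 0)"] entries[of "(Some x, 1)"]
      transversal_word_one_level[OF v x] transversal_word_one_level[OF w x]
    unfolding column_distance_def level_def negative_def by (elim insertE emptyE) simp_all
qed

lemma sum_column_distance_le_hamming:
  assumes "finite N" "finite (supp v)" "finite (supp w)"
  shows "(\<Sum>x\<in>N. column_distance v w x) \<le> hamming v w"
proof -
  let ?D = "{p. v p \<noteq> w p}"
  have "?D \<subseteq> supp v \<union> supp w"
    by (auto simp: supp_def)
  then have "finite ?D"
    using assms by (meson finite_UnI finite_subset)
  have "column_distance v w x = card (?D \<inter> {Some x} \<times> UNIV)" for x
  proof -
    have "?D \<inter> {Some x} \<times> UNIV = (if v (Some x, 0) \<noteq> w (Some x, 0) then {(Some x, 0)} else {}) \<union>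
        (if v (Some x, 1) \<noteq> w (Some x, 1) then {(Some x, 1)} else {})"
      by (auto simp: UNIV_bit)
    then show ?thesis
      by (simp add: column_distance_def)
  qed
  then have "(\<Sum>x\<in>N. column_distance v w x) = (\<Sum>x\<in>N. card (?D \<inter> {Some x} \<times> UNIV))"
    by simp
  also have "\<dots> = card (\<Union>x\<in>N. ?D \<inter> {Some x} \<times> UNIV)"
    using assms(1) \<open>finite ?D\<close> by (intro card_UN_disjoint[symmetric]) auto
  also have "\<dots> \<le> hamming v w"
    unfolding hamming_def using \<open>finite ?D\<close> by (intro card_mono) auto
  finally show ?thesis .
qed

text \<open>With the labels \<open>l x = (level, negative)\<close> in the plane over the field of order 2, the colour is
  \<open>M x (l x) + M y (l y) + M z (l z)\<close> for invertible matrices \<open>M\<close> that map \<open>(0, 1)\<close> to three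
  different vectors, so that changing the signs at two places changes the colour.\<close>

lemma ex_proper_colouring_transversal:
  assumes N: "card N = 3"
  shows "\<exists>f :: ('v option \<times> bit \<Rightarrow> nat) \<Rightarrow> bool \<times> bool. proper_colouring 3 (transversal_words N) f"
proof -
  obtain x y z where xyz: "N = {x, y, z}" "x \<noteq> y" "x \<noteq> z" "y \<noteq> z"
    using N by (auto simp: card_3_iff)
  define f where "f w =
      ((level w x \<noteq> negative w y) \<noteq> (level w z \<noteq> negative w z), (negative w x \<noteq> level w y) \<noteq> negative w z)"
    for w :: "'v option \<times> bit \<Rightarrow> nat"
  have "proper_colouring 3 (transversal_words N) f"
  proof (rule proper_colouringI)
    fix v w
    assume vw: "v \<in> transversal_words N" "w \<in> transversal_words N"
      and eq: "f v = f w" and near: "hamming v w < 3"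
    have "finite (supp v)" "finite (supp w)"
      using vw by (auto simp: transversal_words_def)
    then have "(\<Sum>x\<in>N. column_distance v w x) < 3"
      using near sum_column_distance_le_hamming[of N v w] xyz(1) by simp
    then have sum: "column_distance v w x + column_distance v w y + column_distance v w z < 3"
      using xyz by simp
    have "column_distance v w x = 0 \<and> column_distance v w y = 0 \<and> column_distance v w z = 0"
      using sum eq column_distance_eq[OF vw, of x] column_distance_eq[OF vw, of y]
        column_distance_eq[OF vw, of z]
      unfolding xyz(1) f_def by (auto split: if_splits)
    then have zero: "column_distance v w t = 0" if "t \<in> N" for t
      using that xyz(1) by auto
    show "v = w"
    proof
      fix p
      show "v p = w p"
      proof (cases "fst p \<in> Some ` N")
        case True
        then obtain t b where "p = (Some t, b)" "t \<in> N"
          by (cases p) auto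
        then show ?thesis
          using zero[of t] by (cases b) (auto simp: column_distance_def split: if_splits)
      qed (use transversal_word_outside vw in metis)
    qed
  qed
  then show ?thesis
    by blast
qed

section \<open>Linear spaces\<close>

locale centred_linear_space =
  fixes V :: "'v set" and lines :: "'v set set" and centre :: "'v set \<Rightarrow> 'v"
  assumes line_subset: "L \<in> lines \<Longrightarrow> L \<subseteq> V"
    and ex_line: "x \<in> V \<Longrightarrow> y \<in> V \<Longrightarrow> \<exists>L\<in>lines. {x, y} \<subseteq> L"
    and line_unique: "L \<in> lines \<Longrightarrow> L' \<in> lines \<Longrightarrow> x \<noteq> y \<Longrightarrow> {x, y} \<subseteq> L \<inter> L' \<Longrightarrow> L = L'"
    and centre_off_line: "L \<in> lines \<Longrightarrow> {x, y} \<subseteq> L \<Longrightarrow> x \<noteq> y \<Longrightarrow> z \<in> V - L \<Longrightarrow> centre {x, y, z} \<in> V - L"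
    and inj_on_centre: "L \<in> lines \<Longrightarrow> {x, y} \<subseteq> L \<Longrightarrow> x \<noteq> y \<Longrightarrow> inj_on (\<lambda>z. centre {x, y, z}) (V - L)"
begin

definition collinear :: "'v set \<Rightarrow> bool" where
  "collinear N \<longleftrightarrow> (\<exists>L\<in>lines. N \<subseteq> L)"

lemma centre_noncollinear_inj:
  assumes "x \<noteq> y" "{x, y, z} \<subseteq> V" "{x, y, z'} \<subseteq> V" "\<not> collinear {x, y, z}" "\<not> collinear {x, y, z'}"
    and eq: "centre {x, y, z} = centre {x, y, z'}"
  shows "z = z'"
proof -
  obtain L where L: "L \<in> lines" "{x, y} \<subseteq> L"
    using ex_line[of x y] assms(2) by auto
  then have "z \<in> V - L" "z' \<in> V - L"
    using assms by (auto simp: collinear_def)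
  then show ?thesis
    using inj_on_centre[OF L \<open>x \<noteq> y\<close>] eq by (auto dest: inj_onD)
qed

lemma card_noncollinear_shadow:
  assumes T: "T \<subseteq> doubled V" "card T = 3" "\<not> collinear (shadow T)"
  shows "card (shadow T) = 3"
proof (rule antisym)
  have "finite T"
    using T(2) by (intro card_ge_0_finite) simp
  then show "card (shadow T) \<le> 3"
    using card_shadow_le T(2) by metis
  have shadow: "shadow T \<subseteq> V"
    using T(1) by (simp add: subset_doubled_iff)
  have "shadow T \<noteq> {}"
  proof
    assume "shadow T = {}"
    then have "T \<subseteq> doubled {}"
      by (simp add: subset_doubled_iff)
    then have "card T \<le> card (doubled {} :: ('v option \<times> bit) set)"
      by (intro card_mono finite_doubled) simp_all
    then show False
      using T(2) by (simp add: card_doubled)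
  qed
  moreover have "finite (shadow T)"
    using \<open>finite T\<close> by (rule finite_shadow)
  ultimately have "card (shadow T) > 0"
    by (simp add: card_gt_0_iff)
  show "3 \<le> card (shadow T)"
  proof (rule ccontr)
    assume "\<not> 3 \<le> card (shadow T)"
    with \<open>card (shadow T) > 0\<close> consider "card (shadow T) = 1" | "card (shadow T) = 2"
      by linarith
    then obtain x y where "shadow T = {x, y}"
      by cases (auto simp: card_1_singleton_iff card_2_iff)
    then show False
      using T(3) shadow ex_line[of x y] by (auto simp: collinear_def)
  qed
qed

definition noncollinear_words :: "('v option \<times> bit \<Rightarrow> nat) set" where
  "noncollinear_words = {w \<in> words 3 (doubled V) 3. \<not> collinear (shadow (supp w))}"

lemma noncollinear_word_transversal:
  assumes "w \<in> noncollinear_words"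
  shows "w \<in> transversal_words (shadow (supp w))"
  using assms card_noncollinear_shadow[of "supp w"] in_wordsD[of w 3 "doubled V" 3]
    finite_supp_word[of w 3 "doubled V" 3]
  by (simp add: noncollinear_words_def transversal_words_def)

lemma noncollinear_word_points:
  assumes w: "w \<in> noncollinear_words" and pq: "p \<in> supp w" "q \<in> supp w" "p \<noteq> q"
  obtains x y z where "fst p = Some x" "fst q = Some y" "x \<noteq> y" "shadow (supp w) = {x, y, z}"
proof -
  note transversal = transversal_wordD[OF noncollinear_word_transversal[OF w]]
  obtain x b y c where points: "p = (Some x, b)" "q = (Some y, c)"
    using pq transversal(2) by (cases p; cases q; cases "fst p"; cases "fst q") auto
  then have "x \<noteq> y"
    using pq inj_onD[OF transversal(1), of p q] by auto
  moreover have xy: "x \<in> shadow (supp w)" "y \<in> shadow (supp w)"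
    using pq points by (auto simp: shadow_def)
  moreover have "card (shadow (supp w)) = 3"
    using w card_noncollinear_shadow by (auto simp: noncollinear_words_def words_def)
  ultimately have "card (shadow (supp w) - {x, y}) = 1"
    by (simp add: card_Diff_subset)
  then obtain z where "shadow (supp w) - {x, y} = {z}"
    by (auto simp: card_1_singleton_iff)
  then have "shadow (supp w) = {x, y, z}"
    using xy by blast
  then show thesis
    using that points \<open>x \<noteq> y\<close> by simp
qed

lemma centre_noncollinear_word:
  assumes w: "w \<in> noncollinear_words" and L: "L \<in> lines"
    and pq: "p \<noteq> q" "{p, q} \<subseteq> supp w \<inter> doubled L"
  shows "centre (shadow (supp w)) \<in> V - L"
proof -
  obtain x y z where xyz: "fst p = Some x" "fst q = Some y" "x \<noteq> y" "shadow (supp w) = {x, y, z}"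
    using noncollinear_word_points[OF w, of p q] pq by auto
  have "{x, y} \<subseteq> L"
    using xyz(1,2) pq(2) by (cases p; cases q) (auto simp: doubled_def)
  moreover have "\<not> {x, y, z} \<subseteq> L" "z \<in> V"
    using w L in_wordsD(1)[of w 3 "doubled V" 3] xyz(4)
    by (auto simp: noncollinear_words_def collinear_def subset_doubled_iff)
  ultimately show ?thesis
    using centre_off_line[OF L _ xyz(3), of z] xyz(4) by simp
qed

lemma centre_noncollinear_word_in:
  assumes w: "w \<in> noncollinear_words"
  shows "centre (shadow (supp w)) \<in> V"
proof -
  have words: "w \<in> words 3 (doubled V) 3"
    using w by (simp add: noncollinear_words_def)
  have "hamming w w < 3"
    by (simp add: hamming_def)
  then obtain p q where pq: "p \<noteq> q" "{p, q} \<subseteq> supp w \<inter> supp w"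
    using near_words_common_points[OF words words] by blast
  obtain x y z where xyz: "fst p = Some x" "fst q = Some y" "x \<noteq> y" "shadow (supp w) = {x, y, z}"
    using noncollinear_word_points[OF w, of p q] pq by auto
  then obtain L where L: "L \<in> lines" "{x, y} \<subseteq> L"
    using ex_line[of x y] in_wordsD(1)[OF words] by (auto simp: subset_doubled_iff)
  then have "{p, q} \<subseteq> supp w \<inter> doubled L"
    using pq(2) xyz(1,2) by (cases p; cases q) (auto simp: doubled_def)
  then show ?thesis
    using centre_noncollinear_word[OF w L(1) pq(1)] by simp
qed

lemma ex_proper_colouring_noncollinear:
  "\<exists>g. proper_colouring 3 noncollinear_words (\<lambda>w. (centre (shadow (supp w)), g w :: bool \<times> bool))"
proof -
  obtain g :: "'v set \<Rightarrow> ('v option \<times> bit \<Rightarrow> nat) \<Rightarrow> bool \<times> bool"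
    where g: "\<And>N. card N = 3 \<Longrightarrow> proper_colouring 3 (transversal_words N) (g N)"
    using ex_proper_colouring_transversal by metis
  have "proper_colouring 3 noncollinear_words (\<lambda>w. (centre (shadow (supp w)), g (shadow (supp w)) w))"
  proof (rule proper_colouring_refine[where part = "\<lambda>w. shadow (supp w)"])
    fix v w
    assume vw: "v \<in> noncollinear_words" "w \<in> noncollinear_words" "hamming v w < 3"
      and eq: "centre (shadow (supp v)) = centre (shadow (supp w))"
    have words: "v \<in> words 3 (doubled V) 3" "w \<in> words 3 (doubled V) 3"
      using vw by (auto simp: noncollinear_words_def)
    obtain p q where pq: "p \<noteq> q" "{p, q} \<subseteq> supp v \<inter> supp w"
      using near_words_common_points[OF words vw(3)] .
    obtain x y z where xyz: "fst p = Some x" "fst q = Some y" "x \<noteq> y" "shadow (supp v) = {x, y, z}"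
      using noncollinear_word_points[OF vw(1), of p q] pq by auto
    obtain x' y' z' where "fst p = Some x'" "fst q = Some y'" "x' \<noteq> y'"
        "shadow (supp w) = {x', y', z'}"
      using noncollinear_word_points[OF vw(2), of p q] pq by auto
    then have z': "shadow (supp w) = {x, y, z'}"
      using xyz by simp
    have "shadow (supp v) \<subseteq> V" "shadow (supp w) \<subseteq> V"
      using in_wordsD(1)[OF words(1)] in_wordsD(1)[OF words(2)] by (simp_all add: subset_doubled_iff)
    then have "z = z'"
      using centre_noncollinear_inj[OF xyz(3), of z z'] vw(1,2) eq
      by (simp add: noncollinear_words_def xyz(4) z')
    then show "shadow (supp v) = shadow (supp w)"
      using xyz z' by simp
  next
    fix N
    assume "N \<in> (\<lambda>w. shadow (supp w)) ` noncollinear_words"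
    then have "card N = 3"
      using card_noncollinear_shadow by (auto simp: noncollinear_words_def words_def)
    moreover have "{w \<in> noncollinear_words. shadow (supp w) = N} \<subseteq> transversal_words N"
      using noncollinear_word_transversal by auto
    ultimately show "proper_colouring 3 {w \<in> noncollinear_words. shadow (supp w) = N} (g N)"
      using g[of N] unfolding proper_colouring_def by blast
  qed
  then show ?thesis
    by (rule exI[where x = "\<lambda>w. g (shadow (supp w)) w"])
qed

end

locale resolved_linear_space = centred_linear_space V lines centre
  for V :: "'v set" and lines and centre +
  fixes B :: "'v set \<Rightarrow> ('v option \<times> bit) set set" and cls :: "'v set \<Rightarrow> ('v option \<times> bit) set \<Rightarrow> 'v"
  assumes line_resolution: "L \<in> lines \<Longrightarrow> line_resolution L (B L) (cls L)"
begin

definition blocks :: "('v option \<times> bit) set set" where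
  "blocks = (\<Union>L\<in>lines. B L)"

definition line_of :: "('v option \<times> bit) set \<Rightarrow> 'v set" where
  "line_of b = (SOME L. L \<in> lines \<and> b \<in> B L)"

definition block_class :: "('v option \<times> bit) set \<Rightarrow> 'v" where
  "block_class b = cls (line_of b) b"

lemma line_of:
  assumes "b \<in> blocks"
  shows "line_of b \<in> lines" "b \<in> B (line_of b)"
  using someI_ex[of "\<lambda>L. L \<in> lines \<and> b \<in> B L"] assms unfolding line_of_def blocks_def by blast+

lemma block_line:
  assumes "b \<in> blocks"
  obtains L where "L \<in> lines" "b \<subseteq> doubled L" "block_class b \<in> L"
  using line_resolutionD(2,3)[OF line_resolution[OF line_of(1)] line_of(2)] line_of(1) assms that
  unfolding block_class_def by blast

text \<open>Two blocks on different lines have at most the fibre of one point in common, and this fibre is a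
  block on each of these lines.\<close>

lemma resolved_blocks: "resolved blocks block_class"
  unfolding resolved_def
proof (intro conjI ballI allI impI)
  show "card b = 4" if "b \<in> blocks" for b
    using resolved_card[OF line_resolutionD(1)[OF line_resolution[OF line_of(1)]] line_of(2)] that
    by blast
next
  fix b c p q
  assume b: "b \<in> blocks" and c: "c \<in> blocks" and eq: "block_class b = block_class c"
    and pq: "p \<noteq> q" "{p, q} \<subseteq> b \<inter> c"
  let ?L = "line_of b" and ?M = "line_of c"
  note L = line_of[OF b] and M = line_of[OF c]
  note resL = line_resolutionD[OF line_resolution[OF L(1)]]
    and resM = line_resolutionD[OF line_resolution[OF M(1)]]
  show "b = c"
  proof (cases "?L = ?M")
    case True
    then show ?thesis
      using resolved_eqD[OF resL(1) L(2) _ _ pq] M(2) eq by (simp add: block_class_def)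
  next
    case False
    define x where "x = block_class b"
    have x: "cls ?L b = x" "cls ?M c = x"
      using eq by (simp_all add: x_def block_class_def)
    then have x_in: "x \<in> ?L" "x \<in> ?M"
      using resL(3)[OF L(2)] resM(3)[OF M(2)] by simp_all
    then have "?L \<inter> ?M = {x}"
      using line_unique[OF L(1) M(1)] False by blast
    moreover have "{p, q} \<subseteq> doubled ?L \<inter> doubled ?M"
      using pq(2) resL(2)[OF L(2)] resM(2)[OF M(2)] by auto
    ultimately have fibre: "{p, q} \<subseteq> doubled {x}"
      by (simp add: doubled_Int)
    have "b = doubled {x}"
      by (rule resolved_eqD[OF resL(1) L(2) resL(5)[OF x_in(1)] _ pq(1)])
        (use fibre pq(2) resL(6)[OF x_in(1)] x in simp_all)
    moreover have "c = doubled {x}"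
      by (rule resolved_eqD[OF resM(1) M(2) resM(5)[OF x_in(2)] _ pq(1)])
        (use fibre pq(2) resM(6)[OF x_in(2)] x in simp_all)
    ultimately show ?thesis
      by simp
  qed
qed

lemma supp_in_block_iff:
  assumes w: "w \<in> words 3 (doubled V) 3"
  shows "(\<exists>b\<in>blocks. supp w \<subseteq> b) \<longleftrightarrow> collinear (shadow (supp w))"
proof
  assume "\<exists>b\<in>blocks. supp w \<subseteq> b"
  then obtain b where b: "b \<in> blocks" "supp w \<subseteq> b"
    by blast
  then show "collinear (shadow (supp w))"
    using block_line[OF b(1)] unfolding collinear_def by (metis subset_doubled_iff subset_trans)
next
  assume "collinear (shadow (supp w))"
  then obtain L where L: "L \<in> lines" "supp w \<subseteq> doubled L"
    by (auto simp: collinear_def subset_doubled_iff)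
  then show "\<exists>b\<in>blocks. supp w \<subseteq> b"
    using line_resolutionD(4)[OF line_resolution[OF L(1)] L(2)] in_wordsD(2)[OF w]
    by (auto simp: blocks_def)
qed

lemma block_class_ne_centre:
  assumes b: "b \<in> blocks" "supp v \<subseteq> b" and v: "v \<in> words 3 (doubled V) 3"
    and w: "w \<in> noncollinear_words" and near: "hamming v w < 3"
  shows "block_class b \<noteq> centre (shadow (supp w))"
proof -
  obtain L where L: "L \<in> lines" "b \<subseteq> doubled L" "block_class b \<in> L"
    using block_line[OF b(1)] .
  have "w \<in> words 3 (doubled V) 3"
    using w by (simp add: noncollinear_words_def)
  then obtain p q where pq: "p \<noteq> q" "{p, q} \<subseteq> supp v \<inter> supp w"
    using near_words_common_points[OF v _ near] by blast
  then have "centre (shadow (supp w)) \<in> V - L"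
    using b(2) L(2) by (intro centre_noncollinear_word[OF w L(1) pq(1)]) auto
  then show ?thesis
    using L(3) by auto
qed

theorem ex_proper_colouring:
  "\<exists>f. proper_colouring 3 (words 3 (doubled V) 3) f \<and>
    f ` words 3 (doubled V) 3 \<subseteq> V \<times> (UNIV :: (bool \<times> bool) set)"
proof -
  let ?W = "words 3 (doubled V) 3"
  define in_block where "in_block w \<longleftrightarrow> (\<exists>b\<in>blocks. supp w \<subseteq> b)"
    for w :: "'v option \<times> bit \<Rightarrow> nat"
  define supp_class where "supp_class w = block_class (block_of blocks (supp w))"
    for w :: "'v option \<times> bit \<Rightarrow> nat"
  have block: "block_of blocks (supp w) \<in> blocks" "supp w \<subseteq> block_of blocks (supp w)"
    if "in_block w" for w
    using block_of[of blocks "supp w"] that by (simp_all add: in_block_def)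
  have noncollinear: "noncollinear_words = {w \<in> ?W. \<not> in_block w}"
    using supp_in_block_iff by (auto simp: noncollinear_words_def in_block_def)
  obtain g :: "_ \<Rightarrow> bool \<times> bool"
    where g: "proper_colouring 3 {w \<in> ?W. in_block w} (\<lambda>w. (supp_class w, g w))"
    using ex_proper_colouring_resolved[OF resolved_blocks, of "doubled V"]
    unfolding in_block_def supp_class_def by blast
  obtain h :: "_ \<Rightarrow> bool \<times> bool"
    where h: "proper_colouring 3 {w \<in> ?W. \<not> in_block w} (\<lambda>w. (centre (shadow (supp w)), h w))"
    using ex_proper_colouring_noncollinear unfolding noncollinear by blast
  define f where
    "f w = (if in_block w then (supp_class w, g w) else (centre (shadow (supp w)), h w))" for w
  have "proper_colouring 3 ?W f"
    unfolding f_def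
  proof (rule proper_colouring_if[OF g h])
    fix v w
    assume "v \<in> ?W" "w \<in> ?W" "in_block v" "\<not> in_block w" "hamming v w < 3"
    then show "(supp_class v, g v) \<noteq> (centre (shadow (supp w)), h w)"
      using block_class_ne_centre[OF block] noncollinear by (simp add: supp_class_def)
  qed
  moreover have "f w \<in> V \<times> UNIV" if "w \<in> ?W" for w
  proof (cases "in_block w")
    case True
    then show ?thesis
      using block_line[OF block(1)[OF True]] line_subset by (auto simp: f_def supp_class_def)
  next
    case False
    then show ?thesis
      using centre_noncollinear_word_in that noncollinear by (simp add: f_def)
  qed
  ultimately show ?thesis
    by blast
qed

end

theorem (in centred_linear_space) ex_TOC:
  assumes V: "finite V" "V \<noteq> {}" and k: "odd k" "\<And>L. L \<in> lines \<Longrightarrow> card L + 1 = 2 ^ k"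
  shows "\<exists>P. is_TOC 3 (2 * card V + 2) 3 3 P"
proof -
  obtain B cls where "\<And>L. L \<in> lines \<Longrightarrow> line_resolution L (B L) (cls L)"
    using ex_line_resolution[OF k(1) k(2)] by metis
  then interpret resolved_linear_space V lines centre B cls
    by unfold_locales
  obtain f where f: "proper_colouring 3 (words 3 (doubled V) 3) f"
    "f ` words 3 (doubled V) 3 \<subseteq> V \<times> (UNIV :: (bool \<times> bool) set)"
    using ex_proper_colouring by blast
  have "card V > 0"
    using V by (simp add: card_gt_0_iff)
  have "\<exists>P. is_TOC 3 (card (doubled V)) 3 3 P"
  proof (rule ex_TOC_of_proper_colouring[OF finite_doubled[OF V(1)] _ _ _ _ f, where t = 2])
    show "3 \<le> card (doubled V)"
      using V(1) \<open>card V > 0\<close> by (simp add: card_doubled)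
    show "card (V \<times> (UNIV :: (bool \<times> bool) set))
        \<le> (card (doubled V) - 2 choose (3 - 2)) * (3 - 1) ^ (3 - 2)"
      using V(1) by (simp add: card_doubled card_cartesian_product)
  qed (use V(1) in simp_all)
  then show ?thesis
    using V(1) by (simp add: card_doubled)
qed

section \<open>Affine spaces\<close>

definition affine_space :: "nat \<Rightarrow> (nat \<Rightarrow> 'r::comm_ring_1) set" where
  "affine_space m = {x. \<forall>i\<ge>m. x i = 0}"

definition affine_point :: "(nat \<Rightarrow> 'r::comm_ring_1) \<Rightarrow> (nat \<Rightarrow> 'r) \<Rightarrow> 'r \<Rightarrow> nat \<Rightarrow> 'r" where
  "affine_point p q t = (\<lambda>i. p i + t * (q i - p i))"

definition line_through :: "(nat \<Rightarrow> 'r::comm_ring_1) \<Rightarrow> (nat \<Rightarrow> 'r) \<Rightarrow> (nat \<Rightarrow> 'r) set" where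
  "line_through p q = range (affine_point p q)"

definition affine_lines :: "nat \<Rightarrow> (nat \<Rightarrow> 'r::comm_ring_1) set set" where
  "affine_lines m = {line_through p q |p q. p \<in> affine_space m \<and> q \<in> affine_space m \<and> p \<noteq> q}"

lemma card_affine_space:
  "card (affine_space m :: (nat \<Rightarrow> 'r::{comm_ring_1,finite}) set) = CARD('r) ^ m"
proof -
  have "bij_betw (\<lambda>x. restrict x {..<m}) (affine_space m :: (nat \<Rightarrow> 'r) set) ({..<m} \<rightarrow>\<^sub>E UNIV)"
  proof (rule bij_betw_byWitness[where f' = "\<lambda>x i. if i < m then x i else 0"])
    show "\<forall>x\<in>affine_space m. (\<lambda>i. if i < m then restrict x {..<m} i else 0) = x"
      by (auto simp: affine_space_def fun_eq_iff)
    show "\<forall>x\<in>{..<m} \<rightarrow>\<^sub>E UNIV. restrict (\<lambda>i. if i < m then x i else 0) {..<m} = x"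
      by (auto simp: fun_eq_iff PiE_def extensional_def)
    show "(\<lambda>x. restrict x {..<m}) ` affine_space m \<subseteq> {..<m} \<rightarrow>\<^sub>E UNIV"
      by (simp add: image_subset_iff restrict_PiE_iff)
    show "(\<lambda>x i. if i < m then x i else 0) ` ({..<m} \<rightarrow>\<^sub>E UNIV) \<subseteq> affine_space m"
      by (simp add: image_subset_iff affine_space_def)
  qed
  then show ?thesis
    by (simp add: bij_betw_same_card card_PiE)
qed

lemma finite_affine_space: "finite (affine_space m :: (nat \<Rightarrow> 'r::{comm_ring_1,finite}) set)"
  by (rule card_ge_0_finite) (simp add: card_affine_space)

lemma points_in_line_through: "p \<in> line_through p q" "q \<in> line_through p q"
proof -
  have "affine_point p q 0 = p" "affine_point p q 1 = q"
    by (simp_all add: affine_point_def)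
  then show "p \<in> line_through p q" "q \<in> line_through p q"
    unfolding line_through_def by (metis rangeI)+
qed

lemma affine_point_affine_point:
  "affine_point (affine_point p q s) (affine_point p q t) r = affine_point p q (s + r * (t - s))"
  by (simp add: affine_point_def algebra_simps)

lemma line_through_eq:
  fixes p q :: "nat \<Rightarrow> 'r::comm_ring_1"
  assumes units: "\<And>s::'r. s \<noteq> 0 \<Longrightarrow> s dvd 1"
    and points: "p' \<in> line_through p q" "q' \<in> line_through p q" "p' \<noteq> q'"
  shows "line_through p' q' = line_through p q"
proof -
  obtain s t where st: "p' = affine_point p q s" "q' = affine_point p q t"
    using points by (auto simp: line_through_def)
  have "t - s \<noteq> 0"
    using points(3) st by auto
  then obtain u where u: "1 = (t - s) * u"
    using units[OF \<open>t - s \<noteq> 0\<close>] by (elim dvdE)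
  have "s + (r - s) * u * (t - s) = r" for r
  proof -
    have "s + (r - s) * u * (t - s) = s + (r - s) * ((t - s) * u)"
      by (simp only: ac_simps)
    then show ?thesis
      by (simp flip: u)
  qed
  then have "surj (\<lambda>r. s + r * (t - s))"
    by (metis surj_def)
  moreover have "range (\<lambda>r. affine_point p q (s + r * (t - s))) =
      affine_point p q ` range (\<lambda>r. s + r * (t - s))"
    by (simp add: image_image)
  ultimately have "range (\<lambda>r. affine_point p q (s + r * (t - s))) = range (affine_point p q)"
    by simp
  then show ?thesis
    by (simp add: line_through_def st affine_point_affine_point)
qed

lemma affine_line_eq_line_through:
  fixes L :: "(nat \<Rightarrow> 'r::comm_ring_1) set"
  assumes "\<And>s::'r. s \<noteq> 0 \<Longrightarrow> s dvd 1" "L \<in> affine_lines m" "{x, y} \<subseteq> L" "x \<noteq> y"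
  shows "L = line_through x y"
  using assms line_through_eq unfolding affine_lines_def by blast

lemma card_affine_line:
  fixes L :: "(nat \<Rightarrow> 'r::{comm_ring_1,finite}) set"
  assumes units: "\<And>s::'r. s \<noteq> 0 \<Longrightarrow> s dvd 1" and L: "L \<in> affine_lines m"
  shows "card L = CARD('r)"
proof -
  obtain p q where pq: "L = line_through p q" "p \<noteq> q"
    using L by (auto simp: affine_lines_def)
  then obtain i where "p i \<noteq> q i"
    by blast
  then have "q i - p i \<noteq> 0"
    by simp
  then obtain u where u: "1 = (q i - p i) * u"
    using units by (metis dvdE)
  have "inj (affine_point p q)"
  proof (rule injI)
    fix s t
    assume "affine_point p q s = affine_point p q t"
    then have "s * (q i - p i) = t * (q i - p i)"
      unfolding affine_point_def by (metis add_left_cancel)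
    then have "s * ((q i - p i) * u) = t * ((q i - p i) * u)"
      by (simp flip: mult.assoc)
    then show "s = t"
      by (simp flip: u)
  qed
  then show ?thesis
    by (simp add: pq line_through_def card_image)
qed

lemma affine_line_subset: "L \<in> affine_lines m \<Longrightarrow> L \<subseteq> affine_space m"
  by (auto simp: affine_lines_def line_through_def affine_point_def affine_space_def)

lemma ex_affine_line:
  fixes x y :: "nat \<Rightarrow> 'r::comm_ring_1"
  assumes "m \<ge> 1" and x: "x \<in> affine_space m" and y: "y \<in> affine_space m"
  shows "\<exists>L\<in>affine_lines m. {x, y} \<subseteq> L"
proof -
  obtain z where z: "z \<in> affine_space m" "x \<noteq> z" "y = x \<or> y = z"
  proof (cases "x = y")
    case True
    have "x(0 := x 0 + 1) \<in> affine_space m"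
      using x \<open>m \<ge> 1\<close> by (simp add: affine_space_def)
    moreover have "x \<noteq> x(0 := x 0 + 1)"
      by (metis add_cancel_left_right fun_upd_same zero_neq_one)
    ultimately show thesis
      using that True by blast
  qed (use that y in blast)
  then have "line_through x z \<in> affine_lines m"
    using x by (auto simp: affine_lines_def)
  then show ?thesis
    using z(3) points_in_line_through[where p = x and q = z]
    by (intro bexI[of _ "line_through x z"]) auto
qed

definition centroid :: "'r::comm_ring_1 \<Rightarrow> (nat \<Rightarrow> 'r) set \<Rightarrow> nat \<Rightarrow> 'r" where
  "centroid third N = (\<lambda>i. third * (\<Sum>x\<in>N. x i))"

lemma sum_eq_3_centroid:
  fixes x y z :: "nat \<Rightarrow> 'r::comm_ring_1"
  assumes "3 * third = 1" "x \<noteq> y" "x \<noteq> z" "y \<noteq> z"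
  shows "x i + y i + z i = 3 * centroid third {x, y, z} i"
  using assms by (simp add: centroid_def add.assoc flip: mult.assoc)

lemma centroid_in_affine_space:
  assumes "N \<subseteq> affine_space m"
  shows "centroid third N \<in> affine_space m"
proof -
  have "(\<Sum>x\<in>N. x i) = 0" if "i \<ge> m" for i
    using assms that by (intro sum.neutral) (auto simp: affine_space_def)
  then show ?thesis
    by (simp add: affine_space_def centroid_def)
qed

lemma centroid_off_line:
  fixes x y z :: "nat \<Rightarrow> 'r::comm_ring_1"
  assumes third: "3 * third = 1" and distinct: "x \<noteq> y" "x \<noteq> z" "y \<noteq> z" and z: "z \<notin> line_through x y"
  shows "centroid third {x, y, z} \<notin> line_through x y"
proof
  assume "centroid third {x, y, z} \<in> line_through x y"
  then obtain t where t: "centroid third {x, y, z} = affine_point x y t"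
    unfolding line_through_def by blast
  have "z i = affine_point x y (3 * t - 1) i" for i
  proof -
    have "z i = 3 * affine_point x y t i - x i - y i"
      using sum_eq_3_centroid[OF third distinct, of i] by (simp add: t algebra_simps)
    then show ?thesis
      by (simp add: affine_point_def algebra_simps)
  qed
  then have "z \<in> line_through x y"
    unfolding line_through_def by blast
  then show False
    using z by blast
qed

lemma centroid_eqD:
  fixes x y z :: "nat \<Rightarrow> 'r::comm_ring_1"
  assumes third: "3 * third = 1"
    and distinct: "x \<noteq> y" "x \<noteq> z" "y \<noteq> z" "x \<noteq> z'" "y \<noteq> z'"
    and eq: "centroid third {x, y, z} = centroid third {x, y, z'}"
  shows "z = z'"
proof
  fix i
  have "x i + y i + z i = x i + y i + z' i"
    unfolding sum_eq_3_centroid[OF third distinct(1-3)]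
      sum_eq_3_centroid[OF third distinct(1,4,5)] eq ..
  then show "z i = z' i"
    by simp
qed

lemma centred_linear_space_affine:
  fixes third :: "'r::comm_ring_1"
  assumes units: "\<And>s::'r. s \<noteq> 0 \<Longrightarrow> s dvd 1" and third: "3 * third = 1" and m: "m \<ge> 1"
  shows "centred_linear_space (affine_space m) (affine_lines m) (centroid third)"
proof
  show "L = M" if "L \<in> affine_lines m" "M \<in> affine_lines m" "x \<noteq> y" "{x, y} \<subseteq> L \<inter> M"
    for L M :: "(nat \<Rightarrow> 'r) set" and x y
    using affine_line_eq_line_through[OF units that(1), of x y]
      affine_line_eq_line_through[OF units that(2), of x y] that(3,4) by simp
  show "centroid third {x, y, z} \<in> affine_space m - L"
    if L: "L \<in> affine_lines m" "{x, y} \<subseteq> L" "x \<noteq> y" and z: "z \<in> affine_space m - L" for L and x y z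
  proof -
    have "centroid third {x, y, z} \<in> affine_space m"
      using affine_line_subset[OF L(1)] L(2) z by (intro centroid_in_affine_space) auto
    moreover have "centroid third {x, y, z} \<notin> L"
    proof -
      have "L = line_through x y"
        by (rule affine_line_eq_line_through[OF units L])
      moreover have "x \<noteq> z" "y \<noteq> z"
        using L(2) z by auto
      ultimately show ?thesis
        using centroid_off_line[OF third L(3)] z by simp
    qed
    ultimately show ?thesis
      by blast
  qed
  show "inj_on (\<lambda>z. centroid third {x, y, z}) (affine_space m - L)"
    if "L \<in> affine_lines m" "{x, y} \<subseteq> L" "x \<noteq> y" for L and x y
  proof (rule inj_onI)
    fix z z'
    assume "z \<in> affine_space m - L" "z' \<in> affine_space m - L"
      and "centroid third {x, y, z} = centroid third {x, y, z'}"
    then show "z = z'"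
      using centroid_eqD[OF third \<open>x \<noteq> y\<close>, of z z'] \<open>{x, y} \<subseteq> L\<close> by auto
  qed
qed (rule affine_line_subset ex_affine_line[OF m]; assumption)+

lemma dvd_1_if_prime_CHAR:
  assumes "prime CHAR('r::comm_ring_1)" and "of_int z \<noteq> (0 :: 'r)"
  shows "of_int z dvd (1 :: 'r)"
proof -
  have "\<not> int CHAR('r) dvd z"
    using assms(2) by (simp add: of_int_eq_0_iff_char_dvd)
  then have "coprime (int CHAR('r)) z"
    using assms(1) by (intro prime_imp_coprime) simp_all
  then obtain u v where uv: "u * int CHAR('r) + v * z = 1"
    using bezout_int[of "int CHAR('r)" z] by auto
  have "(1 :: 'r) = of_int v * of_int z"
    using arg_cong[OF uv, of "of_int :: int \<Rightarrow> 'r"] by simp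
  then show ?thesis
    by (rule dvdI[OF trans[OF _ mult.commute]])
qed

lemma bit1_dvd_1:
  assumes "prime CARD('a::finite bit1)" and "s \<noteq> (0 :: 'a bit1)"
  shows "s dvd 1"
proof -
  obtain z where "s = of_int z"
    by (cases s) auto
  then show ?thesis
    using dvd_1_if_prime_CHAR[where 'r = "'a bit1"] assms by simp
qed

theorem ex_TOC_affine_space:
  assumes units: "\<And>s::'r::{comm_ring_1,finite}. s \<noteq> 0 \<Longrightarrow> s dvd 1" and three: "(3::'r) \<noteq> 0"
    and k: "odd k" "CARD('r) + 1 = 2 ^ k" and m: "m \<ge> 1"
  shows "\<exists>P. is_TOC 3 (2 * CARD('r) ^ m + 2) 3 3 P"
proof -
  obtain third :: 'r where third: "3 * third = 1"
    using units[OF three] by (metis dvdE)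
  interpret centred_linear_space "affine_space m :: (nat \<Rightarrow> 'r) set" "affine_lines m" "centroid third"
    by (rule centred_linear_space_affine[OF units third m])
  have "affine_space m \<noteq> ({} :: (nat \<Rightarrow> 'r) set)"
    by (auto simp: affine_space_def)
  then have "\<exists>P. is_TOC 3 (2 * card (affine_space m :: (nat \<Rightarrow> 'r) set) + 2) 3 3 P"
    using finite_affine_space k
    by (intro ex_TOC[OF _ _ k(1)]) (simp_all add: card_affine_line[OF units])
  then show ?thesis
    by (simp add: card_affine_space)
qed

lemma centred_linear_space_single_line: "centred_linear_space V {V} centre"
  by standard auto

theorem ex_TOC_power_of_four:
  assumes "m \<ge> 1"
  shows "\<exists>P. is_TOC 3 (4 ^ m) 3 3 P"
proof -
  define k where "k = 2 * m - 1"
  have k: "odd k" "2 * 2 ^ k = (4::nat) ^ m"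
    using assms by (simp_all add: k_def power_mult flip: power_Suc)
  then have "(2::nat) ^ k > 1"
    by (intro one_less_power) (auto intro: odd_pos)
  interpret centred_linear_space "{..<2 ^ k - 1 :: nat}" "{{..<2 ^ k - 1}}" "\<lambda>_. 0"
    by (rule centred_linear_space_single_line)
  have "\<exists>P. is_TOC 3 (2 * (2 ^ k - 1) + 2) 3 3 P"
    using ex_TOC[OF _ _ k(1)] \<open>2 ^ k > 1\<close> by (simp add: lessThan_empty_iff)
  moreover have "2 * (2 ^ k - 1) + 2 = (4::nat) ^ m"
    using k(2) \<open>2 ^ k > 1\<close> by simp
  ultimately show ?thesis
    by simp
qed

theorem theorem4p4:
  fixes n :: nat
  assumes "n \<in> Kset"
  shows "\<exists>P. is_TOC 3 n 3 3 P"
proof -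
  consider (power_of_four) m where "m \<ge> 1" "n = 4 ^ m"
    | (field_7) m where "m \<ge> 1" "n = 2 * 7 ^ m + 2"
    | (field_31) m where "m \<ge> 1" "n = 2 * 31 ^ m + 2"
    | (field_127) m where "m \<ge> 1" "n = 2 * 127 ^ m + 2"
    using assms unfolding Kset_def by blast
  then show ?thesis
  proof cases
    case power_of_four
    then show ?thesis
      using ex_TOC_power_of_four by simp
  next
    case field_7
    then show ?thesis
      using ex_TOC_affine_space[where 'r = 7, OF bit1_dvd_1, of 3 m] by simp
  next
    case field_31
    then show ?thesis
      using ex_TOC_affine_space[where 'r = 31, OF bit1_dvd_1, of 5 m] by simp
  next
    case field_127
    then show ?thesis
      using ex_TOC_affine_space[where 'r = 127, OF bit1_dvd_1, of 7 m] by simp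
  qed
qed

end
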